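(* Let $G$ be a finite graph with vertex set $V(G)=\{v_1,\dots,v_n\}$ in which every vertex has even degree. Suppose that the graph polynomial $F_G$ has at least one non-zero almost central coefficient. Let $k\geqslant 2$ be an integer and let $H=G\square C_{2k}$. Then the central coefficient of $F_H$ is non-zero. In particular, $H$ is $(\deg_H/2+1)$-choosable (i.e. $f$-choosable for $f(v)=\deg_H(v)/2+1$), and \[ \operatorname{ch}(H)\leqslant \operatorname{AT}(H)\leqslant \frac{\Delta(H)}{2}+1=\frac{\Delta(G)}{2}+2. \]
   Context: For a graph $G$ on vertices $v_1,\dots,v_n$, the graph polynomial is $F_G(x_1,\dots,x_n)=\prod_{(i,j)\in E(G)}(x_j-x_i)$ (one linear factor per edge, so defined up to sign), with integer coefficients. For a multi-index $\xi=(\xi_1,\dots,\xi_n)$, $[{\bf x}^\xi]F_G$ denotes the coefficient of $\prod_i x_i^{\xi_i}$ in $F_G$. This coefficient is called central if $\xi_i=\deg_G(v_i)/2$ for all $i$, and almost central if $|\xi_i-\deg_G(v_i)/2|\leqslant 1$ for all $i$. $C_m$ denotes the simple cycle with $m$ edges. The Cartesian product $G_1\square G_2$ has vertex set $V(G_1)\times V(G_2)$, with $(v_1,v_2)$ and $(u_1,u_2)$ adjacent iff either $v_1=u_1$ and $v_2u_2\in E(G_2)$, or $v_2=u_2$ and $v_1u_1\in E(G_1)$. For $f:V\to\mathbb{Z}_{>0}$, a graph is $f$-choosable if for every assignment of lists $L(v)$ of colors with $|L(v)|\geqslant f(v)$ there is a proper coloring choosing each vertex's color from its list. $\operatorname{ch}(G)$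 is the least $m$ such that $G$ is $f$-choosable for the constant function $f\equiv m$. $\operatorname{AT}(G)$ (Alon–Tarsi number) is the least $k$ such that there is a monomial ${\bf x}^{\bf d}$ with $\max_i d_i=k-1$ and $[{\bf x}^{\bf d}]F_G\neq 0$. $\Delta(\cdot)$ denotes maximum degree. *)

theory Defs
  imports Complex_Main "HOL-Library.Poly_Mapping"
begin

section \<open>Finite simple graphs\<close>

record 'a graph =
  verts :: "'a set"
  edges :: "'a set set"

definition simple_graph :: "'a graph \<Rightarrow> bool" where
  "simple_graph G \<longleftrightarrow> (\<forall>e\<in>edges G. e \<subseteq> verts G \<and> card e = 2)"

definition degree :: "'a graph \<Rightarrow> 'a \<Rightarrow> nat" where
  "degree G v = card {e \<in> edges G. v \<in> e}"

text \<open>Meaningful only for a finite non-empty vertex set, as \<open>Max\<close> is.\<close>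

definition max_degree :: "'a graph \<Rightarrow> nat" where
  "max_degree G = Max (degree G ` verts G)"

text \<open>A simple graph for \<open>m \<ge> 3\<close> only.\<close>

definition cycle_graph :: "nat \<Rightarrow> nat graph" where
  "cycle_graph m = \<lparr>verts = {..<m}, edges = {{i, (i + 1) mod m} | i. i < m}\<rparr>"

definition cartesian_product :: "'a graph \<Rightarrow> 'b graph \<Rightarrow> ('a \<times> 'b) graph" where
  "cartesian_product G1 G2 =
    \<lparr>verts = verts G1 \<times> verts G2,
     edges = {{(v1, v2), (u1, u2)} | v1 v2 u1 u2.
                v1 \<in> verts G1 \<and> u1 \<in> verts G1 \<and> v2 \<in> verts G2 \<and> u2 \<in> verts G2 \<and>
                (v1 = u1 \<and> {v2, u2} \<in> edges G2 \<or> v2 = u2 \<and> {v1, u1} \<in> edges G1)}\<rparr>"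

section \<open>The graph polynomial\<close>

text \<open>Integer polynomials in variables indexed by \<open>'v\<close>: finitely supported maps from
  exponent vectors to coefficients, with the convolution product of \<open>Poly_Mapping\<close>.\<close>

type_synonym 'v int_mpoly = "('v \<Rightarrow>\<^sub>0 nat) \<Rightarrow>\<^sub>0 int"

definition var :: "'v \<Rightarrow> 'v int_mpoly" where
  "var v = Poly_Mapping.single (Poly_Mapping.single v 1) 1"

definition coefficient :: "'v int_mpoly \<Rightarrow> ('v \<Rightarrow>\<^sub>0 nat) \<Rightarrow> int" where
  "coefficient F \<xi> = Poly_Mapping.lookup F \<xi>"

definition orientation :: "'a graph \<Rightarrow> ('a \<times> 'a) set \<Rightarrow> bool" where
  "orientation G D \<longleftrightarrow> bij_betw (\<lambda>(u, v). {u, v}) D (edges G)"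

definition oriented_poly :: "('a \<times> 'a) set \<Rightarrow> 'a int_mpoly" where
  "oriented_poly D = (\<Prod>(u, v)\<in>D. var v - var u)"

text \<open>The polynomial is only determined up to sign, so an arbitrary orientation is fixed;
  see \<open>graph_poly_up_to_sign\<close> below.\<close>

definition graph_poly :: "'a graph \<Rightarrow> 'a int_mpoly" where
  "graph_poly G = oriented_poly (SOME D. orientation G D)"

lemma orientation_exists:
  assumes "simple_graph G"
  shows "\<exists>D. orientation G D"
proof -
  have "\<forall>e\<in>edges G. \<exists>p. e = (\<lambda>(u, v). {u, v}) p"
    using assms by (fastforce simp: simple_graph_def card_2_iff)
  then obtain f where f: "\<And>e. e \<in> edges G \<Longrightarrow> (\<lambda>(u, v). {u, v}) (f e) = e"
    by metis
  have "bij_betw (\<lambda>(u, v). {u, v}) (f ` edges G) (edges G)"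
    by (rule bij_betw_byWitness[where f' = f]) (use f in \<open>simp_all add: image_subset_iff\<close>)
  then show ?thesis unfolding orientation_def by blast
qed

lemma oriented_poly_up_to_sign:
  assumes "orientation G D" "orientation G D'"
  shows "oriented_poly D = oriented_poly D' \<or> oriented_poly D = - oriented_poly D'"
proof -
  let ?h = "\<lambda>(u, v). {u, v}" and ?g = "\<lambda>(u, v). var v - var u :: 'a int_mpoly"
  define g where "g = inv_into D' ?h \<circ> ?h"
  have bij: "bij_betw g D D'"
    unfolding g_def using assms bij_betw_inv_into bij_betw_trans
    unfolding orientation_def by blast
  have same: "?h (g p) = ?h p" if "p \<in> D" for p
    using that assms unfolding g_def orientation_def
    by (simp add: bij_betw_inv_into_right bij_betw_apply)
  have sign: "?g p = ?g (g p) \<or> ?g p = - ?g (g p)" if "p \<in> D" for p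
    using same[OF that] by (auto simp: doubleton_eq_iff split: prod.splits)
  have "(\<Prod>p\<in>A. ?g p) = (\<Prod>p\<in>A. ?g (g p)) \<or> (\<Prod>p\<in>A. ?g p) = - (\<Prod>p\<in>A. ?g (g p))"
    if "A \<subseteq> D" for A
    using that
  proof (induction A rule: infinite_finite_induct)
    case (insert p A)
    then have "?g p = ?g (g p) \<or> ?g p = - ?g (g p)" using sign by blast
    with insert show ?case by (auto simp del: minus_diff_eq)
  qed auto
  moreover have "(\<Prod>p\<in>D. ?g (g p)) = (\<Prod>p\<in>D'. ?g p)"
    by (rule prod.reindex_bij_betw[OF bij])
  ultimately show ?thesis unfolding oriented_poly_def by (metis order_refl)
qed

lemma graph_poly_up_to_sign:
  assumes "simple_graph G" "orientation G D"
  shows "graph_poly G = oriented_poly D \<or> graph_poly G = - oriented_poly D"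
  unfolding graph_poly_def
  by (rule oriented_poly_up_to_sign[OF someI_ex[OF orientation_exists[OF assms(1)]] assms(2)])

definition central :: "'a graph \<Rightarrow> ('a \<Rightarrow>\<^sub>0 nat) \<Rightarrow> bool" where
  "central G \<xi> \<longleftrightarrow> Poly_Mapping.keys \<xi> \<subseteq> verts G \<and>
    (\<forall>v\<in>verts G. real (Poly_Mapping.lookup \<xi> v) = real (degree G v) / 2)"

definition almost_central :: "'a graph \<Rightarrow> ('a \<Rightarrow>\<^sub>0 nat) \<Rightarrow> bool" where
  "almost_central G \<xi> \<longleftrightarrow> Poly_Mapping.keys \<xi> \<subseteq> verts G \<and>
    (\<forall>v\<in>verts G. \<bar>real (Poly_Mapping.lookup \<xi> v) - real (degree G v) / 2\<bar> \<le> 1)"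

section \<open>Choosability and the Alon--Tarsi number\<close>

definition proper_coloring :: "'a graph \<Rightarrow> ('a \<Rightarrow> 'c) \<Rightarrow> bool" where
  "proper_coloring G c \<longleftrightarrow> (\<forall>u v. {u, v} \<in> edges G \<longrightarrow> c u \<noteq> c v)"

text \<open>Since larger (or infinite) lists may be cut down and only finitely many colors occur on a
  finite graph, finite lists of natural numbers lose no generality.\<close>

definition choosable :: "'a graph \<Rightarrow> ('a \<Rightarrow> nat) \<Rightarrow> bool" where
  "choosable G f \<longleftrightarrow>
    (\<forall>L :: 'a \<Rightarrow> nat set. (\<forall>v\<in>verts G. finite (L v) \<and> f v \<le> card (L v)) \<longrightarrow>
      (\<exists>c. (\<forall>v\<in>verts G. c v \<in> L v) \<and> proper_coloring G c))"

definition choice_number :: "'a graph \<Rightarrow> nat" where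
  "choice_number G = (LEAST m. 0 < m \<and> choosable G (\<lambda>_. m))"

definition alon_tarsi_number :: "'a graph \<Rightarrow> nat" where
  "alon_tarsi_number G =
    (LEAST k. \<exists>d. Poly_Mapping.keys d \<subseteq> verts G \<and>
       k = Max (Poly_Mapping.lookup d ` verts G) + 1 \<and>
       coefficient (graph_poly G) d \<noteq> 0)"

end

(* Expand F_H by choosing an end of every cycle edge; these choices form a cyclic sequence
   T_0, ..., T_{2k-1} of subsets of V(G), and the layer between T and T' must contribute the
   coefficient of F_G at deg/2 + 1_T - 1_{T'}. So, up to signs, the central coefficient of F_H is
   the trace of M^{2k}, where M(T, T') is that coefficient. Since F_G is homogeneous,
   M(T, T') = 0 unless |T| = |T'|, and the signs cancel because the cycle is even. Exchanging the
   ends of all edges of G shows M^T = (-1)^{|E(G)|} M, whence tr M^{2k} is up to sign the squared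
   Frobenius norm of M^k. The entries of M are exactly the almost central coefficients of F_G, and
   a non-zero (anti)symmetric real matrix is not nilpotent. Choosability follows by the
   Alon-Tarsi argument. *)

theory Submission
  imports Defs "HOL-Library.FuncSet"
begin

section \<open>Powers of matrices that are symmetric up to a sign\<close>

text \<open>The obstacle is cancellation: the central coefficient is a signed count of selections
  with nothing positive about it. Even length helps twice. It removes the signs of the cycle edges,
  and it lets a closed walk be cut into two halves of equal length, which transposition makes equal
  up to a common sign; this is where the squares come from. The bound 1 in "almost central" has a
  simple origin: the two cycle edges at a vertex contribute 0, 1 or 2 to its exponent, while the
  central exponent there is \<open>d v + 1\<close>, so a layer has to supply \<open>d v + 1\<close>,
  \<open>d v\<close> or \<open>d v - 1\<close>. Every almost central exponent arises in this way, so
  one non-zero coefficient among them is the same as \<open>M\<close> being non-zero. Non-nilpotency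
  is proved by repeated squaring, which keeps the whole argument over the integers.\<close>

fun walk_sum :: "'b set \<Rightarrow> ('b \<Rightarrow> 'b \<Rightarrow> int) \<Rightarrow> nat \<Rightarrow> 'b \<Rightarrow> 'b \<Rightarrow> int" where
  "walk_sum X M 0 x y = of_bool (x = y)"
| "walk_sum X M (Suc n) x y = (\<Sum>z\<in>X. walk_sum X M n x z * M z y)"

lemma walk_sum_1:
  assumes "finite X" "x \<in> X"
  shows "walk_sum X M (Suc 0) x y = M x y"
proof -
  have "walk_sum X M (Suc 0) x y = (\<Sum>z\<in>X. if x = z then M z y else 0)"
    by (auto intro!: sum.cong)
  then show ?thesis using assms by simp
qed

text \<open>\<open>walk_sum X M n\<close> is the \<open>n\<close>-th power of the matrix
  \<open>M\<close> indexed by \<open>X\<close>, and this is the law of exponents. It is what allows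
  a walk to be cut anywhere, whereas the recursion only removes the last step.\<close>

lemma walk_sum_add:
  assumes "finite X" "y \<in> X"
  shows "walk_sum X M (m + n) x y = (\<Sum>z\<in>X. walk_sum X M m x z * walk_sum X M n z y)"
  using assms(2)
proof (induction n arbitrary: y)
  case 0
  have "(\<Sum>z\<in>X. walk_sum X M m x z * walk_sum X M 0 z y)
      = (\<Sum>z\<in>X. if y = z then walk_sum X M m x z else 0)"
    by (auto intro!: sum.cong)
  then show ?case using 0 assms by simp
next
  case (Suc n)
  have "walk_sum X M (m + Suc n) x y
      = (\<Sum>u\<in>X. (\<Sum>z\<in>X. walk_sum X M m x z * walk_sum X M n z u) * M u y)"
    using Suc.IH by (auto intro!: sum.cong)
  also have "\<dots> = (\<Sum>u\<in>X. \<Sum>z\<in>X. walk_sum X M m x z * (walk_sum X M n z u * M u y))"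
    by (simp add: sum_distrib_right mult.assoc)
  also have "\<dots> = (\<Sum>z\<in>X. \<Sum>u\<in>X. walk_sum X M m x z * (walk_sum X M n z u * M u y))"
    by (rule sum.swap)
  finally show ?case by (simp add: sum_distrib_left)
qed

lemma walk_sum_transpose:
  assumes "finite X" "\<And>x y. x \<in> X \<Longrightarrow> y \<in> X \<Longrightarrow> M y x = \<epsilon> * M x y" "x \<in> X" "y \<in> X"
  shows "walk_sum X M n y x = \<epsilon> ^ n * walk_sum X M n x y"
  using assms(3,4)
proof (induction n arbitrary: x y)
  case (Suc n)
  \<comment> \<open>Transposition exchanges first and last steps, so one of the two sides has to be
    split at its first step.\<close>
  have "walk_sum X M (Suc n) x y = (\<Sum>z\<in>X. M x z * walk_sum X M n z y)"
    using walk_sum_add[of X y M 1 n x] walk_sum_1[of X x M] Suc.prems assms(1) by simp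
  moreover have "walk_sum X M (Suc n) y x = (\<Sum>z\<in>X. \<epsilon> ^ Suc n * (M x z * walk_sum X M n z y))"
    unfolding walk_sum.simps
  proof (rule sum.cong)
    fix z assume "z \<in> X"
    then show "walk_sum X M n y z * M z x = \<epsilon> ^ Suc n * (M x z * walk_sum X M n z y)"
      using Suc.IH[of z y] Suc.prems assms(2)[of x z] by (simp only:) simp
  qed simp
  ultimately show ?case by (simp add: sum_distrib_left)
qed auto

text \<open>The second half of a closed walk, read backwards, runs between the same ends as the
  first half, at the cost of \<open>\<epsilon>\<close> per step.\<close>

lemma walk_sum_diag:
  assumes "finite X" "\<And>x y. x \<in> X \<Longrightarrow> y \<in> X \<Longrightarrow> M y x = \<epsilon> * M x y" "x \<in> X"
  shows "walk_sum X M (n + n) x x = \<epsilon> ^ n * (\<Sum>y\<in>X. (walk_sum X M n x y)\<^sup>2)"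
proof -
  have "walk_sum X M (n + n) x x
      = (\<Sum>y\<in>X. walk_sum X M n x y * (\<epsilon> ^ n * walk_sum X M n x y))"
    unfolding walk_sum_add[OF assms(1,3)]
    by (intro sum.cong arg_cong2[where f = "(*)"] walk_sum_transpose[where M = M, OF assms]) simp_all
  then show ?thesis by (simp add: sum_distrib_left power2_eq_square algebra_simps)
qed

text \<open>A non-zero entry in row \<open>x\<close> of a power makes the diagonal entry at
  \<open>x\<close> of its square a non-zero multiple of a positive sum of squares. Hence all powers
  with exponent \<open>2 ^ j\<close> are non-zero.\<close>

lemma walk_sum_neq_0:
  assumes "finite X" "\<And>x y. x \<in> X \<Longrightarrow> y \<in> X \<Longrightarrow> M y x = \<epsilon> * M x y" "\<epsilon> \<noteq> 0"
    and "\<exists>x\<in>X. \<exists>y\<in>X. M x y \<noteq> 0"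
  shows "\<exists>x\<in>X. \<exists>y\<in>X. walk_sum X M n x y \<noteq> 0"
proof -
  have pow: "\<exists>x\<in>X. \<exists>y\<in>X. walk_sum X M (2 ^ j) x y \<noteq> 0" for j
  proof (induction j)
    case 0
    then show ?case using assms(4) walk_sum_1[OF assms(1)] by auto
  next
    case (Suc j)
    then obtain x y where xy: "x \<in> X" "y \<in> X" "walk_sum X M (2 ^ j) x y \<noteq> 0" by blast
    have "(\<Sum>y\<in>X. (walk_sum X M (2 ^ j) x y)\<^sup>2) > 0"
      using xy assms(1) by (intro sum_pos2[of X y]) auto
    then have "walk_sum X M (2 ^ j + 2 ^ j) x x \<noteq> 0"
      using walk_sum_diag[where M = M, OF assms(1,2) xy(1)] assms(3) by simp
    then show ?case using xy by (auto simp: mult_2)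
  qed
  \<comment> \<open>Every \<open>n\<close> lies below some power of two, and a factor of a non-zero
    product of matrices is non-zero.\<close>
  have "2 ^ n = n + (2 ^ n - n)" by (simp add: less_imp_le)
  then obtain r where r: "2 ^ n = n + r" by blast
  obtain x y where xy: "x \<in> X" "y \<in> X" "walk_sum X M (2 ^ n) x y \<noteq> 0" using pow by blast
  from xy(3) have "(\<Sum>z\<in>X. walk_sum X M n x z * walk_sum X M r z y) \<noteq> 0"
    unfolding r walk_sum_add[OF assms(1) xy(2)] .
  then obtain z where "z \<in> X" "walk_sum X M n x z * walk_sum X M r z y \<noteq> 0"
    by (rule sum.not_neutral_contains_not_neutral)
  then show ?thesis using xy by auto
qed

lemma trace_walk_sum_neq_0:
  assumes "finite X" "\<And>x y. x \<in> X \<Longrightarrow> y \<in> X \<Longrightarrow> M y x = \<epsilon> * M x y" "\<epsilon> \<noteq> 0"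
    and "\<exists>x\<in>X. \<exists>y\<in>X. M x y \<noteq> 0"
  shows "(\<Sum>x\<in>X. walk_sum X M (2 * n) x x) \<noteq> 0"
proof -
  obtain x y where xy: "x \<in> X" "y \<in> X" "walk_sum X M n x y \<noteq> 0"
    using walk_sum_neq_0[where M = M, OF assms] by blast
  have "(\<Sum>y\<in>X. (walk_sum X M n x y)\<^sup>2) > 0"
    using xy assms(1) by (intro sum_pos2[of X y]) auto
  then have "(\<Sum>x\<in>X. \<Sum>y\<in>X. (walk_sum X M n x y)\<^sup>2) > 0"
    by (rule sum_pos2[OF assms(1) xy(1)]) (simp add: sum_nonneg)
  moreover have "(\<Sum>x\<in>X. walk_sum X M (2 * n) x x)
      = \<epsilon> ^ n * (\<Sum>x\<in>X. \<Sum>y\<in>X. (walk_sum X M n x y)\<^sup>2)"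
    unfolding mult_2 using walk_sum_diag[where M = M, OF assms(1,2)] by (simp add: sum_distrib_left)
  ultimately show ?thesis using assms(3) by simp
qed

text \<open>The weight \<open>h\<close> on the two ends is arbitrary for the sake of the induction:
  the last step of a longer walk is absorbed into the weight of the shorter one.\<close>

lemma sum_PiE_walk_sum:
  assumes "finite X"
  shows "(\<Sum>T\<in>PiE {..n} (\<lambda>_. X). (\<Prod>i<n. M (T i) (T (Suc i))) * h (T 0) (T n))
       = (\<Sum>x\<in>X. \<Sum>y\<in>X. walk_sum X M n x y * h x y)"
proof (induction n arbitrary: h)
  case 0
  have "(\<Sum>T\<in>PiE {..0::nat} (\<lambda>_. X). (\<Prod>i<0::nat. M (T i) (T (Suc i))) * h (T 0) (T 0))
      = (\<Sum>x\<in>X. h x x)"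
    by (rule sum.reindex_bij_witness[of _ "\<lambda>x. restrict (\<lambda>_. x) {..0}" "\<lambda>T. T 0"])
       (auto simp: PiE_def extensional_def)
  moreover have "(\<Sum>x\<in>X. \<Sum>y\<in>X. walk_sum X M 0 x y * h x y)
      = (\<Sum>x\<in>X. \<Sum>y\<in>X. if x = y then h x y else 0)"
    by (auto intro!: sum.cong)
  ultimately show ?case using assms by simp
next
  case (Suc n)
  let ?f = "\<lambda>T. (\<Prod>i<Suc n. M (T i) (T (Suc i))) * h (T 0) (T (Suc n))"
  have "(\<Sum>T\<in>PiE {..Suc n} (\<lambda>_. X). ?f T)
      = (\<Sum>(y, T)\<in>X \<times> PiE {..n} (\<lambda>_. X). ?f (T(Suc n := y)))"
    unfolding atMost_Suc PiE_insert_eq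
    by (subst sum.reindex[OF inj_combinator]) (auto intro!: sum.cong)
  also have "\<dots> = (\<Sum>y\<in>X. \<Sum>T\<in>PiE {..n} (\<lambda>_. X).
      (\<Prod>i<n. M (T i) (T (Suc i))) * (M (T n) y * h (T 0) y))"
    by (auto simp: sum.cartesian_product intro!: sum.cong)
  also have "\<dots> = (\<Sum>y\<in>X. \<Sum>x\<in>X. \<Sum>z\<in>X. walk_sum X M n x z * (M z y * h x y))"
    using Suc.IH[of "\<lambda>x z. M z y * h x y" for y] by simp
  also have "\<dots> = (\<Sum>x\<in>X. \<Sum>y\<in>X. \<Sum>z\<in>X. walk_sum X M n x z * (M z y * h x y))"
    by (rule sum.swap)
  finally show ?case by (simp add: sum_distrib_right mult.assoc)
qed

lemma sum_PiE_closed_walks: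
  assumes "finite X"
  shows "(\<Sum>T\<in>PiE {..<Suc n} (\<lambda>_. X). \<Prod>i<Suc n. M (T i) (T (Suc i mod Suc n)))
       = (\<Sum>x\<in>X. walk_sum X M (Suc n) x x)"
proof -
  have "(\<Prod>i<Suc n. M (T i) (T (Suc i mod Suc n)))
      = (\<Prod>i<n. M (T i) (T (Suc i))) * M (T n) (T 0)" for T
    by (auto intro!: prod.cong)
  \<comment> \<open>Here \<open>h\<close> is the closing step from the last vertex back to the
    first, the only one where the index wraps around.\<close>
  then show ?thesis
    using sum_PiE_walk_sum[OF assms, where h = "\<lambda>x y. M y x"] by (simp add: lessThan_Suc_atMost)
qed

section \<open>Expanding products of differences of variables\<close>

text \<open>The exponent of the monomial obtained from \<open>\<Prod>e\<in>A. (h e - t e)\<close> by selecting the tail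
  \<open>t e\<close> for \<open>e \<in> S\<close> and the head \<open>h e\<close> otherwise.\<close>

definition selection :: "('e \<Rightarrow> 'v) \<Rightarrow> ('e \<Rightarrow> 'v) \<Rightarrow> 'e set \<Rightarrow> 'e set \<Rightarrow> 'v \<Rightarrow>\<^sub>0 nat" where
  "selection t h A S = (\<Sum>e\<in>S. Poly_Mapping.single (t e) 1) + (\<Sum>e\<in>A - S. Poly_Mapping.single (h e) 1)"

lemma lookup_single_of_bool:
  "Poly_Mapping.lookup (Poly_Mapping.single u c) v = of_bool (u = v) * (c :: 'c :: semiring_1)"
  by (simp add: lookup_single when_def)

lemma lookup_selection:
  "Poly_Mapping.lookup (selection t h A S) v
     = (\<Sum>e\<in>S. of_bool (t e = v)) + (\<Sum>e\<in>A - S. of_bool (h e = v))"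
  by (simp add: selection_def lookup_add lookup_sum lookup_single_of_bool)

lemma prod_single:
  "(\<Prod>i\<in>I. Poly_Mapping.single (a i) (b i))
     = Poly_Mapping.single (\<Sum>i\<in>I. a i :: 'v \<Rightarrow>\<^sub>0 nat) (\<Prod>i\<in>I. b i :: int)"
  by (induction I rule: infinite_finite_induct) (auto simp: mult_single)

lemma prod_var_diff:
  assumes "finite A"
  shows "(\<Prod>e\<in>A. var (h e) - var (t e))
       = (\<Sum>S\<in>Pow A. Poly_Mapping.single (selection t h A S) ((-1) ^ card S))"
proof -
  have sgn: "(-1 :: 'v int_mpoly) ^ n = Poly_Mapping.single 0 ((-1) ^ n)" for n
    by (induction n) (auto simp: mult_single single_uminus[symmetric])
  show ?thesis
    unfolding prod_diff_conv_sum[OF assms] var_def selection_def prod_single sgn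
    by (simp add: mult_single)
qed

section \<open>The transfer matrix of a layer\<close>

text \<open>\<open>T\<close> and \<open>T'\<close> are the vertices whose cycle edge entering, respectively leaving, a given layer
  selects its tail. The condition says that the layer must contribute the remaining exponents of
  the central monomial; it is stated without subtraction, so that no truncation occurs.\<close>

definition transfer :: "('a \<times> 'a) set \<Rightarrow> 'a set \<Rightarrow> ('a \<Rightarrow> nat) \<Rightarrow> 'a set \<Rightarrow> 'a set \<Rightarrow> int" where
  "transfer D V d T T' = (\<Sum>S\<in>Pow D. (-1) ^ card S *
     of_bool (\<forall>v\<in>V. Poly_Mapping.lookup (selection fst snd D S) v + of_bool (v \<in> T')
       = d v + of_bool (v \<in> T)))"

lemma of_bool_Ball:
  "finite A \<Longrightarrow> of_bool (\<forall>i\<in>A. P i) = (\<Prod>i\<in>A. of_bool (P i) :: int)"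
  by (induction A rule: finite_induct) auto

text \<open>A selection and its complement together pick both ends of every arc once, so their
  exponents add up to the degree.\<close>

lemma lookup_selection_tails_heads:
  assumes "finite A" "S \<subseteq> A"
  shows "Poly_Mapping.lookup (selection t h A S) v + Poly_Mapping.lookup (selection t h A (A - S)) v
       = (\<Sum>e\<in>A. of_bool (t e = v) + of_bool (h e = v))"
proof -
  have "A - (A - S) = S" using assms by blast
  moreover have "sum f A = sum f S + sum f (A - S)" for f :: "'a \<Rightarrow> nat"
    using sum.subset_diff[OF assms(2,1), of f] by simp
  ultimately show ?thesis by (simp add: lookup_selection sum.distrib)
qed

lemma lookup_selection_eq_0:
  assumes "S \<subseteq> A" "v \<notin> t ` A" "v \<notin> h ` A"
  shows "Poly_Mapping.lookup (selection t h A S) v = 0"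
proof -
  have "(\<Sum>e\<in>S. of_bool (t e = v)) = (0 :: nat)" "(\<Sum>e\<in>A - S. of_bool (h e = v)) = (0 :: nat)"
    using assms by (auto intro!: sum.neutral)
  then show ?thesis by (simp only: lookup_selection)
qed

text \<open>Homogeneity: each factor contributes exactly one variable. It serves both to compare set
  sizes across a layer and to compare monomials in the Alon-Tarsi argument.\<close>

lemma sum_lookup_selection:
  assumes "finite A" "finite V" "S \<subseteq> A" "t ` A \<subseteq> V" "h ` A \<subseteq> V"
  shows "(\<Sum>v\<in>V. Poly_Mapping.lookup (selection t h A S) v) = card A"
proof -
  have single: "(\<Sum>v\<in>V. of_bool (f e = v)) = (1 :: nat)" if "e \<in> A" "f ` A \<subseteq> V" for f e
  proof -
    have "(\<Sum>v\<in>V. of_bool (f e = v)) = (\<Sum>v\<in>V. if f e = v then 1 else 0 :: nat)"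
      by (auto intro!: sum.cong)
    then show ?thesis using that assms(2) by (auto simp: image_subset_iff)
  qed
  have "(\<Sum>v\<in>V. Poly_Mapping.lookup (selection t h A S) v)
      = (\<Sum>e\<in>S. \<Sum>v\<in>V. of_bool (t e = v)) + (\<Sum>e\<in>A - S. \<Sum>v\<in>V. of_bool (h e = v))"
    unfolding lookup_selection sum.distrib
    by (intro arg_cong2[where f = "(+)"] sum.swap)
  also have "\<dots> = (\<Sum>e\<in>S. 1) + (\<Sum>e\<in>A - S. 1)"
    using assms(3-5) by (intro arg_cong2[where f = "(+)"] sum.cong single) auto
  also have "\<dots> = card A"
    using assms(1,3) by (simp add: card_Diff_subset card_mono finite_subset)
  finally show ?thesis .
qed

text \<open>This models an orientation of a graph with even degrees, \<open>d\<close> being half the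
  degree. Arc ends are counted instead of edges because exponents of selections count arc ends as
  well.\<close>

locale balanced_arcs =
  fixes D :: "('a \<times> 'a) set" and V :: "'a set" and d :: "'a \<Rightarrow> nat"
  assumes finite_V: "finite V" and D_sub: "D \<subseteq> V \<times> V"
    and half_degree: "\<And>v. v \<in> V \<Longrightarrow> (\<Sum>e\<in>D. of_bool (fst e = v) + of_bool (snd e = v)) = 2 * d v"
begin

lemma finite_D: "finite D"
  using finite_subset[OF D_sub] finite_V by blast

lemma complement:
  assumes "S \<subseteq> D" "v \<in> V"
  shows "Poly_Mapping.lookup (selection fst snd D S) v
       + Poly_Mapping.lookup (selection fst snd D (D - S)) v = 2 * d v"
  using lookup_selection_tails_heads[OF finite_D assms(1), of fst snd v] half_degree[OF assms(2)]
  by (simp only:)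

lemma sum_selection:
  assumes "S \<subseteq> D"
  shows "(\<Sum>v\<in>V. Poly_Mapping.lookup (selection fst snd D S) v) = card D"
proof -
  have "fst ` D \<subseteq> V" "snd ` D \<subseteq> V" using D_sub by auto
  then show ?thesis by (rule sum_lookup_selection[OF finite_D finite_V assms])
qed

text \<open>A handshake identity: the all-heads and the all-tails selection both have total degree
  \<open>card D\<close>, and together they exhaust the degrees.\<close>

lemma sum_half_degree: "(\<Sum>v\<in>V. d v) = card D"
proof -
  have "2 * (\<Sum>v\<in>V. d v) = (\<Sum>v\<in>V. Poly_Mapping.lookup (selection fst snd D {}) v
      + Poly_Mapping.lookup (selection fst snd D (D - {})) v)"
    using complement[of "{}"] by (simp add: sum_distrib_left)
  then show ?thesis using sum_selection[of "{}"] sum_selection[of D] by (simp add: sum.distrib)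
qed

text \<open>Selecting the opposite end of every edge turns the exponent \<open>\<xi>\<close> into \<open>deg - \<xi>\<close>.\<close>

lemma transfer_swap:
  "transfer D V d T' T = (-1) ^ card D * transfer D V d T T'"
proof -
  have "transfer D V d T' T = (\<Sum>S\<in>Pow D. (-1) ^ card (D - S) *
     of_bool (\<forall>v\<in>V. Poly_Mapping.lookup (selection fst snd D (D - S)) v + of_bool (v \<in> T)
       = d v + of_bool (v \<in> T')))"
    unfolding transfer_def
    by (rule sum.reindex_bij_witness[of _ "\<lambda>S. D - S" "\<lambda>S. D - S"]) (auto simp: double_diff)
  also have "\<dots> = (\<Sum>S\<in>Pow D. (-1) ^ card D * ((-1) ^ card S *
     of_bool (\<forall>v\<in>V. Poly_Mapping.lookup (selection fst snd D S) v + of_bool (v \<in> T')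
       = d v + of_bool (v \<in> T))))"
  proof (rule sum.cong)
    fix S assume "S \<in> Pow D"
    then have S: "S \<subseteq> D" by simp
    have "card D = card S + card (D - S)"
      using S finite_D by (metis card_Diff_subset card_mono finite_subset le_add_diff_inverse)
    then have "(-1 :: int) ^ card (D - S) = (-1) ^ card D * (-1) ^ card S"
      by (simp add: power_add flip: power_mult_distrib)
    moreover have "(\<forall>v\<in>V. Poly_Mapping.lookup (selection fst snd D (D - S)) v + of_bool (v \<in> T)
          = d v + of_bool (v \<in> T'))
        \<longleftrightarrow> (\<forall>v\<in>V. Poly_Mapping.lookup (selection fst snd D S) v + of_bool (v \<in> T')
          = d v + of_bool (v \<in> T))"
    proof (rule ball_cong)
      fix v assume "v \<in> V"
      \<comment> \<open>If the two selections have exponents \<open>a\<close> and \<open>b\<close>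
        at \<open>v\<close>, then \<open>a + b = 2 * d v\<close> means
        \<open>b - d v = d v - a\<close>, and the two equations prescribe the same value for this
        difference.\<close>
      from complement[OF S this]
      show "(Poly_Mapping.lookup (selection fst snd D (D - S)) v + of_bool (v \<in> T)
            = d v + of_bool (v \<in> T'))
          \<longleftrightarrow> (Poly_Mapping.lookup (selection fst snd D S) v + of_bool (v \<in> T')
            = d v + of_bool (v \<in> T))"
        by linarith
    qed simp
    ultimately show "(-1) ^ card (D - S) *
       of_bool (\<forall>v\<in>V. Poly_Mapping.lookup (selection fst snd D (D - S)) v + of_bool (v \<in> T)
         = d v + of_bool (v \<in> T'))
     = (-1 :: int) ^ card D * ((-1) ^ card S *
       of_bool (\<forall>v\<in>V. Poly_Mapping.lookup (selection fst snd D S) v + of_bool (v \<in> T')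
         = d v + of_bool (v \<in> T)))"
      by simp
  qed simp
  finally show ?thesis by (simp add: transfer_def sum_distrib_left)
qed

text \<open>This is where homogeneity of \<open>F_G\<close> enters: it makes the signs of the cycle edges agree
  in all layers.\<close>

lemma transfer_card_eq:
  assumes "transfer D V d T T' \<noteq> 0" "T \<subseteq> V" "T' \<subseteq> V"
  shows "card T = card T'"
proof -
  obtain S where S: "S \<subseteq> D" and
    eq: "\<forall>v\<in>V. Poly_Mapping.lookup (selection fst snd D S) v + of_bool (v \<in> T')
       = d v + of_bool (v \<in> T)"
    using sum.not_neutral_contains_not_neutral[OF assms(1)[unfolded transfer_def]] by auto
  \<comment> \<open>Summed over \<open>V\<close>, the selection and \<open>d\<close> both give
    \<open>card D\<close>; what remains are the sizes of the two sets.\<close>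
  have "(\<Sum>v\<in>V. Poly_Mapping.lookup (selection fst snd D S) v + of_bool (v \<in> T'))
      = (\<Sum>v\<in>V. d v + of_bool (v \<in> T))"
    using eq by (intro sum.cong) auto
  then have "(\<Sum>v\<in>V. of_bool (v \<in> T') :: nat) = (\<Sum>v\<in>V. of_bool (v \<in> T))"
    by (simp only: sum.distrib sum_selection[OF S] sum_half_degree add_left_cancel)
  moreover have "V \<inter> {v. v \<in> T} = T" "V \<inter> {v. v \<in> T'} = T'" using assms by auto
  ultimately show ?thesis using finite_V by (simp add: sum_of_bool_eq)
qed

end

section \<open>The polynomial of the product with a cycle\<close>

lemma sum_of_bool_point:
  "finite S \<Longrightarrow> (\<Sum>w\<in>S. of_bool (w = v)) = (of_bool (v \<in> S) :: nat)"
proof -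
  assume "finite S"
  moreover have "(\<Sum>w\<in>S. of_bool (w = v)) = (\<Sum>w\<in>S. if w = v then 1 else 0 :: nat)"
    by (auto intro!: sum.cong)
  ultimately show ?thesis by simp
qed

lemma sum_of_bool_pair:
  "finite S \<Longrightarrow> (\<Sum>w\<in>S. of_bool ((w, i) = (v, j))) = (of_bool (v \<in> S \<and> i = j) :: nat)"
  using sum_of_bool_point[of S v] by (cases "i = j") auto

lemma bij_betw_Suc_mod:
  assumes "m > 0"
  shows "bij_betw (\<lambda>i. Suc i mod m) {..<m} {..<m}"
proof -
  have "inj_on (\<lambda>i. Suc i mod m) {..<m}"
    by (rule inj_onI) (auto simp: mod_Suc split: if_splits)
  moreover have "(\<lambda>i. Suc i mod m) ` {..<m} \<subseteq> {..<m}" using assms by auto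
  ultimately show ?thesis by (simp add: bij_betw_def endo_inj_surj)
qed

text \<open>Index \<open>i\<close> is given to the layer in which rung \<open>i\<close> ends. With
  this shift the layer of index \<open>i\<close> lies between rungs \<open>i\<close> and
  \<open>Suc i mod m\<close>, so its condition couples \<open>T i\<close> with
  \<open>T (Suc i mod m)\<close>.\<close>

definition cylinder_poly :: "('a \<times> 'a) set \<Rightarrow> 'a set \<Rightarrow> nat \<Rightarrow> ('a \<times> nat) int_mpoly" where
  "cylinder_poly D V m =
     (\<Prod>i<m. \<Prod>e\<in>D. var (snd e, Suc i mod m) - var (fst e, Suc i mod m)) *
     (\<Prod>i<m. \<Prod>v\<in>V. var (v, Suc i mod m) - var (v, i))"

lemma lookup_sum_layers:
  assumes "m > 0" "j < m"
  shows "(\<Sum>i<m. Poly_Mapping.lookup (selection (\<lambda>e. (fst e, Suc i mod m)) (\<lambda>e. (snd e, Suc i mod m))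
            D (S i)) (v, Suc j mod m))
       = Poly_Mapping.lookup (selection fst snd D (S j)) v"
proof -
  have eq: "Suc i mod m = Suc j mod m \<longleftrightarrow> i = j" if "i < m" for i
    using bij_betw_Suc_mod[OF assms(1)] that assms(2)
    by (auto simp: bij_betw_def dest: inj_onD)
  have "(\<Sum>i<m. Poly_Mapping.lookup (selection (\<lambda>e. (fst e, Suc i mod m)) (\<lambda>e. (snd e, Suc i mod m))
            D (S i)) (v, Suc j mod m))
      = (\<Sum>i<m. if i = j then Poly_Mapping.lookup (selection fst snd D (S i)) v else 0)"
    by (rule sum.cong) (simp_all add: lookup_selection eq)
  then show ?thesis using assms(2) by simp
qed

text \<open>The point \<open>(v, Suc j mod m)\<close> is the tail of one rung, with index
  \<open>Suc j mod m\<close>, and the head of one rung, with index \<open>j\<close>.\<close>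

lemma lookup_sum_rungs:
  assumes "m > 0" "j < m" "finite V" "v \<in> V" "\<And>i. i < m \<Longrightarrow> T i \<subseteq> V"
  shows "(\<Sum>i<m. Poly_Mapping.lookup (selection (\<lambda>v. (v, i)) (\<lambda>v. (v, Suc i mod m)) V (T i))
            (v, Suc j mod m))
       = of_bool (v \<in> T (Suc j mod m)) + of_bool (v \<notin> T j)"
proof -
  have eq: "Suc i mod m = Suc j mod m \<longleftrightarrow> i = j" if "i < m" for i
    using bij_betw_Suc_mod[OF assms(1)] that assms(2)
    by (auto simp: bij_betw_def dest: inj_onD)
  have "(\<Sum>i<m. Poly_Mapping.lookup (selection (\<lambda>v. (v, i)) (\<lambda>v. (v, Suc i mod m)) V (T i))
            (v, Suc j mod m))
      = (\<Sum>i<m. (if i = Suc j mod m then of_bool (v \<in> T i) else 0)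
          + (if i = j then of_bool (v \<notin> T i) else 0))"
  proof (rule sum.cong)
    fix i assume "i \<in> {..<m}"
    then have i: "i < m" by simp
    have fin: "finite (T i)" using assms(3) assms(5)[OF i] finite_subset by blast
    show "Poly_Mapping.lookup (selection (\<lambda>v. (v, i)) (\<lambda>v. (v, Suc i mod m)) V (T i))
            (v, Suc j mod m)
        = (if i = Suc j mod m then of_bool (v \<in> T i) else 0)
          + (if i = j then of_bool (v \<notin> T i) else 0)"
      using assms(3,4) fin
      by (simp only: lookup_selection sum_of_bool_pair finite_Diff eq[OF i]) auto
  qed simp
  then show ?thesis using assms(1,2) by (simp add: sum.distrib)
qed

section \<open>The central coefficient as the trace of a matrix power\<close>

context balanced_arcs
begin

text \<open>The \<open>+ 1\<close> is half of the two rungs at each point.\<close>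

definition central_exponent :: "nat \<Rightarrow> ('a \<times> nat) \<Rightarrow>\<^sub>0 nat" where
  "central_exponent m = (\<Sum>x\<in>V \<times> {..<m}. Poly_Mapping.single x (d (fst x) + 1))"

lemma lookup_central_exponent:
  "Poly_Mapping.lookup (central_exponent m) x = (if x \<in> V \<times> {..<m} then d (fst x) + 1 else 0)"
proof -
  have "Poly_Mapping.lookup (central_exponent m) x
      = (\<Sum>y\<in>V \<times> {..<m}. if y = x then d (fst y) + 1 else 0)"
    unfolding central_exponent_def lookup_sum by (rule sum.cong) (auto simp: lookup_single when_def)
  then show ?thesis using finite_V by simp
qed

text \<open>The exponent from the rungs is \<open>[v in T (Suc i mod m)] + 1 - [v in T i]\<close>.
  Its \<open>1\<close> cancels the one in \<open>d v + 1\<close>, and moving the negative term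
  across gives exactly the condition inside \<open>transfer\<close>.\<close>

lemma selection_sum_eq_central_iff:
  assumes "m > 0" "\<And>i. i < m \<Longrightarrow> S i \<subseteq> D" "\<And>i. i < m \<Longrightarrow> T i \<subseteq> V"
  shows "(\<Sum>i<m. selection (\<lambda>e. (fst e, Suc i mod m)) (\<lambda>e. (snd e, Suc i mod m)) D (S i)) +
         (\<Sum>i<m. selection (\<lambda>v. (v, i)) (\<lambda>v. (v, Suc i mod m)) V (T i)) = central_exponent m
     \<longleftrightarrow> (\<forall>i<m. \<forall>v\<in>V. Poly_Mapping.lookup (selection fst snd D (S i)) v + of_bool (v \<in> T (Suc i mod m))
           = d v + of_bool (v \<in> T i))"
    (is "?L + ?R = _ \<longleftrightarrow> _")
proof -
  have outside: "Poly_Mapping.lookup (?L + ?R) x = 0" if "x \<notin> V \<times> {..<m}" for x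
  proof -
    have "Poly_Mapping.lookup ?L x = 0" unfolding lookup_sum
    proof (rule sum.neutral, rule ballI)
      fix i assume "i \<in> {..<m}"
      then show "Poly_Mapping.lookup (selection (\<lambda>e. (fst e, Suc i mod m)) (\<lambda>e. (snd e, Suc i mod m)) D (S i)) x = 0"
        using that D_sub assms(1) by (intro lookup_selection_eq_0 assms(2)) auto
    qed
    moreover have "Poly_Mapping.lookup ?R x = 0" unfolding lookup_sum
    proof (rule sum.neutral, rule ballI)
      fix i assume "i \<in> {..<m}"
      then show "Poly_Mapping.lookup (selection (\<lambda>v. (v, i)) (\<lambda>v. (v, Suc i mod m)) V (T i)) x = 0"
        using that assms(1) by (intro lookup_selection_eq_0 assms(3)) auto
    qed
    ultimately show ?thesis by (simp add: lookup_add)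
  qed
  have inside: "Poly_Mapping.lookup (?L + ?R) (v, Suc j mod m)
      = Poly_Mapping.lookup (selection fst snd D (S j)) v
        + (of_bool (v \<in> T (Suc j mod m)) + of_bool (v \<notin> T j))" if "j < m" "v \<in> V" for v j
    using lookup_sum_layers[OF assms(1) that(1)] lookup_sum_rungs[OF assms(1) that(1) finite_V that(2) assms(3)]
    by (simp add: lookup_add lookup_sum)
  have "?L + ?R = central_exponent m \<longleftrightarrow>
      (\<forall>x\<in>V \<times> {..<m}. Poly_Mapping.lookup (?L + ?R) x = d (fst x) + 1)"
    (is "_ \<longleftrightarrow> ?P")
  proof
    assume "?L + ?R = central_exponent m"
    then show ?P by (auto simp: lookup_central_exponent)
  next
    assume P: ?P
    show "?L + ?R = central_exponent m"
    proof (rule poly_mapping_eqI)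
      fix x
      show "Poly_Mapping.lookup (?L + ?R) x = Poly_Mapping.lookup (central_exponent m) x"
        unfolding lookup_central_exponent using outside[of x] bspec[OF P, of x] by argo
    qed
  qed
  also have "\<dots> \<longleftrightarrow> (\<forall>v\<in>V. \<forall>i\<in>{..<m}. Poly_Mapping.lookup (?L + ?R) (v, i) = d v + 1)"
    by auto
  \<comment> \<open>Heights are written as cyclic successors, the form in which
    \<open>inside\<close> computes the exponent.\<close>
  also have "\<dots> \<longleftrightarrow> (\<forall>v\<in>V. \<forall>i\<in>(\<lambda>i. Suc i mod m) ` {..<m}.
      Poly_Mapping.lookup (?L + ?R) (v, i) = d v + 1)"
    using bij_betw_Suc_mod[OF assms(1)] by (simp add: bij_betw_def)
  also have "\<dots> \<longleftrightarrow> (\<forall>i<m. \<forall>v\<in>V. Poly_Mapping.lookup (selection fst snd D (S i)) v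
      + of_bool (v \<in> T (Suc i mod m)) = d v + of_bool (v \<in> T i))"
  proof -
    have "(\<forall>v\<in>V. \<forall>i\<in>(\<lambda>i. Suc i mod m) ` {..<m}. Poly_Mapping.lookup (?L + ?R) (v, i) = d v + 1)
        \<longleftrightarrow> (\<forall>i<m. \<forall>v\<in>V. Poly_Mapping.lookup (?L + ?R) (v, Suc i mod m) = d v + 1)"
      by blast
    also have "\<dots> \<longleftrightarrow> (\<forall>i<m. \<forall>v\<in>V. Poly_Mapping.lookup (selection fst snd D (S i)) v
        + of_bool (v \<in> T (Suc i mod m)) = d v + of_bool (v \<in> T i))"
    proof (intro all_cong ball_cong refl)
      fix i v assume "i < m" "v \<in> V"
      show "Poly_Mapping.lookup (?L + ?R) (v, Suc i mod m) = d v + 1 \<longleftrightarrow>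
          Poly_Mapping.lookup (selection fst snd D (S i)) v
          + of_bool (v \<in> T (Suc i mod m)) = d v + of_bool (v \<in> T i)"
        unfolding inside[OF \<open>i < m\<close> \<open>v \<in> V\<close>] by (cases "v \<in> T i") simp_all
    qed
    finally show ?thesis .
  qed
  finally show ?thesis .
qed

text \<open>Equality of exponents is a conjunction of conditions, one per layer, hence its indicator
  is a product over \<open>i\<close>; the sum over all selections then factors as well.\<close>

lemma coefficient_cylinder_poly:
  assumes "m > 0"
  shows "coefficient (cylinder_poly D V m) (central_exponent m)
       = (\<Sum>T\<in>PiE {..<m} (\<lambda>_. Pow V). \<Prod>i<m. (-1) ^ card (T i) * transfer D V d (T i) (T (Suc i mod m)))"
proof -
  let ?mL = "\<lambda>i. selection (\<lambda>e. (fst e, Suc i mod m)) (\<lambda>e. (snd e, Suc i mod m)) D"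
  let ?mR = "\<lambda>i. selection (\<lambda>v. (v, i)) (\<lambda>v. (v, Suc i mod m)) V"
  let ?PD = "PiE {..<m} (\<lambda>_. Pow D)" and ?PV = "PiE {..<m} (\<lambda>_. Pow V)"
  let ?P = "\<lambda>S T T'. \<forall>v\<in>V. Poly_Mapping.lookup (selection fst snd D S) v + of_bool (v \<in> T')
           = d v + of_bool (v \<in> T)"
  have L: "(\<Prod>i<m. \<Prod>e\<in>D. var (snd e, Suc i mod m) - var (fst e, Suc i mod m))
      = (\<Sum>S\<in>?PD. Poly_Mapping.single (\<Sum>i<m. ?mL i (S i)) (\<Prod>i<m. (-1) ^ card (S i)))"
    unfolding prod_var_diff[OF finite_D]
    by (subst prod_sum_PiE) (use finite_D in \<open>simp_all add: prod_single\<close>)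
  have R: "(\<Prod>i<m. \<Prod>v\<in>V. var (v, Suc i mod m) - var (v, i))
      = (\<Sum>T\<in>?PV. Poly_Mapping.single (\<Sum>i<m. ?mR i (T i)) (\<Prod>i<m. (-1) ^ card (T i)))"
    unfolding prod_var_diff[OF finite_V]
    by (subst prod_sum_PiE) (use finite_V in \<open>simp_all add: prod_single\<close>)
  have "coefficient (cylinder_poly D V m) (central_exponent m)
      = (\<Sum>S\<in>?PD. \<Sum>T\<in>?PV. of_bool ((\<Sum>i<m. ?mL i (S i)) + (\<Sum>i<m. ?mR i (T i)) = central_exponent m) *
          ((\<Prod>i<m. (-1) ^ card (S i)) * (\<Prod>i<m. (-1) ^ card (T i))))"
    unfolding coefficient_def cylinder_poly_def L R sum_product mult_single lookup_sum lookup_single_of_bool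
    by simp
  also have "\<dots> = (\<Sum>S\<in>?PD. \<Sum>T\<in>?PV. (\<Prod>i<m. (-1) ^ card (T i) *
      ((-1) ^ card (S i) * of_bool (?P (S i) (T i) (T (Suc i mod m))))))"
  proof (intro sum.cong refl)
    fix S T assume ST: "S \<in> ?PD" "T \<in> ?PV"
    have "S i \<subseteq> D" "T i \<subseteq> V" if "i < m" for i
      using PiE_mem[OF ST(1), of i] PiE_mem[OF ST(2), of i] that by auto
    then have "of_bool ((\<Sum>i<m. ?mL i (S i)) + (\<Sum>i<m. ?mR i (T i)) = central_exponent m)
        = (of_bool (\<forall>i\<in>{..<m}. ?P (S i) (T i) (T (Suc i mod m))) :: int)"
      by (subst selection_sum_eq_central_iff[OF assms]) auto
    also have "\<dots> = (\<Prod>i<m. of_bool (?P (S i) (T i) (T (Suc i mod m))))"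
      by (rule of_bool_Ball) simp
    finally have e: "of_bool ((\<Sum>i<m. ?mL i (S i)) + (\<Sum>i<m. ?mR i (T i)) = central_exponent m)
        = (\<Prod>i<m. of_bool (?P (S i) (T i) (T (Suc i mod m))) :: int)" .
    show "of_bool ((\<Sum>i<m. ?mL i (S i)) + (\<Sum>i<m. ?mR i (T i)) = central_exponent m) *
          ((\<Prod>i<m. (-1) ^ card (S i)) * (\<Prod>i<m. (-1) ^ card (T i)))
        = (\<Prod>i<m. (-1) ^ card (T i) *
      ((-1) ^ card (S i) * of_bool (?P (S i) (T i) (T (Suc i mod m)))) :: int)"
      unfolding e prod.distrib by (simp only: mult_ac)
  qed
  \<comment> \<open>For fixed \<open>T\<close> the set \<open>S i\<close> occurs only in the factor
    of index \<open>i\<close>, so the inner sum becomes a product of \<open>transfer\<close>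
    entries.\<close>
  also have "\<dots> = (\<Sum>T\<in>?PV. \<Sum>S\<in>?PD. (\<Prod>i<m. (-1) ^ card (T i) *
      ((-1) ^ card (S i) * of_bool (?P (S i) (T i) (T (Suc i mod m))))))"
    by (rule sum.swap)
  also have "\<dots> = (\<Sum>T\<in>?PV. \<Prod>i<m. (-1) ^ card (T i) * transfer D V d (T i) (T (Suc i mod m)))"
    unfolding transfer_def sum_distrib_left
    by (subst prod_sum_PiE) (use finite_D in simp_all)
  finally show ?thesis .
qed

lemma coefficient_cylinder_poly_even:
  assumes "m > 0" "even m"
  shows "coefficient (cylinder_poly D V m) (central_exponent m)
       = (\<Sum>T\<in>Pow V. walk_sum (Pow V) (transfer D V d) m T T)"
proof -
  let ?PV = "PiE {..<m} (\<lambda>_. Pow V)"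
  have "(\<Sum>T\<in>?PV. \<Prod>i<m. (-1) ^ card (T i) * transfer D V d (T i) (T (Suc i mod m)))
      = (\<Sum>T\<in>?PV. \<Prod>i<m. transfer D V d (T i) (T (Suc i mod m)))"
  proof (rule sum.cong)
    fix T assume T: "T \<in> ?PV"
    show "(\<Prod>i<m. (-1) ^ card (T i) * transfer D V d (T i) (T (Suc i mod m)))
      = (\<Prod>i<m. transfer D V d (T i) (T (Suc i mod m)))"
    \<comment> \<open>If some entry vanishes, both products are 0. Otherwise all \<open>T i\<close>
      have the same size.\<close>
    proof (cases "\<forall>i<m. transfer D V d (T i) (T (Suc i mod m)) \<noteq> 0")
      case True
      have sub: "T i \<subseteq> V" if "i < m" for i using PiE_mem[OF T, of i] that by auto
      have step: "card (T (Suc i mod m)) = card (T i)" if "i < m" for i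
        using transfer_card_eq[of "T i" "T (Suc i mod m)"] True sub that assms(1) by auto
      have const: "card (T i) = card (T 0)" if "i < m" for i
        using that
      proof (induction i)
        case (Suc i)
        then show ?case using step[of i] by simp
      qed simp
      have "(\<Prod>i<m. (-1 :: int) ^ card (T i)) = (\<Prod>i<m. (-1) ^ card (T 0))"
        by (intro prod.cong arg_cong[where f = "\<lambda>n. (-1) ^ n"] const) simp_all
      \<comment> \<open>A sign raised to the even power \<open>m\<close>.\<close>
      also have "\<dots> = 1" using assms(2) by (simp add: minus_one_power_iff)
      finally show ?thesis by (simp add: prod.distrib)
    next
      case False
      then obtain i where "i < m" "transfer D V d (T i) (T (Suc i mod m)) = 0" by blast
      then show ?thesis by (auto simp: prod.distrib intro!: prod_zero)
    qed
  qed simp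
  then show ?thesis
    using coefficient_cylinder_poly[OF assms(1)] sum_PiE_closed_walks[of "Pow V" "transfer D V d" "m - 1"]
      assms(1) finite_V by simp
qed

lemma central_coefficient_neq_0:
  assumes "k > 0" "transfer D V d T T' \<noteq> 0" "T \<subseteq> V" "T' \<subseteq> V"
  shows "coefficient (cylinder_poly D V (2 * k)) (central_exponent (2 * k)) \<noteq> 0"
proof -
  have "(\<Sum>T\<in>Pow V. walk_sum (Pow V) (transfer D V d) (2 * k) T T) \<noteq> 0"
  proof (rule trace_walk_sum_neq_0)
    show "transfer D V d y x = (-1) ^ card D * transfer D V d x y" for x y
      by (rule transfer_swap)
    show "\<exists>x\<in>Pow V. \<exists>y\<in>Pow V. transfer D V d x y \<noteq> 0" using assms(2-4) by blast
  qed (simp_all add: finite_V)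
  then show ?thesis using coefficient_cylinder_poly_even[of "2 * k"] assms(1) by simp
qed

end

section \<open>Choosability from a non-zero coefficient\<close>

text \<open>The weights are \<open>w a = 1 / (\<Prod>b\<in>A - {a}. a - b)\<close>, that is, the functional is the divided
  difference on \<open>A\<close>.\<close>

lemma lagrange_weights:
  fixes A :: "'k :: field set"
  assumes "finite A" "card A = Suc n"
  shows "\<exists>w. \<forall>j\<le>n. (\<Sum>a\<in>A. w a * a ^ j) = of_bool (j = n)"
  using assms
proof (induction n arbitrary: A)
  case 0
  then obtain a where "A = {a}" by (auto simp: card_Suc_eq)
  then show ?case by (intro exI[of _ "\<lambda>_. 1"]) auto
next
  case (Suc n)
  then obtain b B where A: "A = insert b B" "b \<notin> B" "card B = Suc n" "finite B"
    by (metis card_Suc_eq finite_insert)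
  obtain w where w: "\<And>j. j \<le> n \<Longrightarrow> (\<Sum>a\<in>B. w a * a ^ j) = of_bool (j = n)"
    using Suc.IH[OF A(4,3)] by blast
  \<comment> \<open>A new node \<open>b\<close> divides the old weights by \<open>a - b\<close>; its
    own weight is chosen to make the moment of order 0 vanish.\<close>
  define u where "u = (\<lambda>a. w a / (a - b))"
  define w' where "w' = u(b := - (\<Sum>a\<in>B. u a))"
  have sum_A: "(\<Sum>a\<in>A. w' a * a ^ j) = (\<Sum>a\<in>B. u a * a ^ j) - (\<Sum>a\<in>B. u a) * b ^ j" for j
  proof -
    have "(\<Sum>a\<in>B. w' a * a ^ j) = (\<Sum>a\<in>B. u a * a ^ j)"
      using A(2) by (intro sum.cong) (auto simp: w'_def)
    then show ?thesis using A by (simp add: w'_def)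
  qed
  \<comment> \<open>From \<open>a = b + (a - b)\<close>, where the factor \<open>a - b\<close> turns
    \<open>u a\<close> back into \<open>w a\<close>: each new moment is \<open>b\<close> times the
    preceding one plus an old moment.\<close>
  have step: "(\<Sum>a\<in>A. w' a * a ^ Suc j) = b * (\<Sum>a\<in>A. w' a * a ^ j) + (\<Sum>a\<in>B. w a * a ^ j)" for j
  proof -
    have "u a * a ^ Suc j = b * (u a * a ^ j) + w a * a ^ j" if "a \<in> B" for a
    proof -
      have "u a * (a - b) = w a" using that A(2) by (auto simp: u_def)
      then show ?thesis by (auto simp: algebra_simps simp flip: \<open>u a * (a - b) = w a\<close>)
    qed
    then have "(\<Sum>a\<in>B. u a * a ^ Suc j) = (\<Sum>a\<in>B. b * (u a * a ^ j) + w a * a ^ j)"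
      by (intro sum.cong) auto
    then show ?thesis unfolding sum_A by (simp add: sum.distrib sum_distrib_left algebra_simps)
  qed
  have zero: "(\<Sum>a\<in>A. w' a * a ^ j) = 0" if "j \<le> n" for j
    using that
  proof (induction j)
    case 0
    then show ?case using sum_A[of 0] by simp
  next
    case (Suc j)
    then show ?case unfolding step using w[of j] by simp
  qed
  have "(\<Sum>a\<in>A. w' a * a ^ Suc n) = 1"
    unfolding step using zero[of n] w[of n] by simp
  with zero show ?case by (intro exI[of _ w']) (auto simp: le_Suc_eq)
qed

section \<open>Evaluating the edge product on a grid of lists\<close>

lemma coefficient_prod_var_diff:
  assumes "finite A"
  shows "coefficient (\<Prod>e\<in>A. var (h e) - var (t e)) \<xi>
       = (\<Sum>S\<in>Pow A. (-1) ^ card S * of_bool (selection t h A S = \<xi>))"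
  unfolding coefficient_def prod_var_diff[OF assms] lookup_sum lookup_single_of_bool
  by (simp add: mult.commute)

text \<open>This evaluates the monomial of a selection at the coloring \<open>c\<close>, so that the
  edge product can be expanded numerically in parallel with the polynomial.\<close>

lemma prod_power_selection:
  fixes c :: "'v \<Rightarrow> 'k :: comm_semiring_1"
  assumes "finite V" "S \<subseteq> A" "t ` A \<subseteq> V" "h ` A \<subseteq> V"
  shows "(\<Prod>v\<in>V. c v ^ Poly_Mapping.lookup (selection t h A S) v)
       = (\<Prod>e\<in>S. c (t e)) * (\<Prod>e\<in>A - S. c (h e))"
proof -
  have point: "(\<Prod>v\<in>V. c v ^ of_bool (u = v)) = c u" if "u \<in> V" for u
  proof -
    have "(\<Prod>v\<in>V. c v ^ of_bool (u = v)) = (\<Prod>v\<in>V. if u = v then c v else 1)"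
      by (intro prod.cong) auto
    then show ?thesis using that assms(1) by simp
  qed
  have "(\<Prod>v\<in>V. c v ^ Poly_Mapping.lookup (selection t h A S) v)
      = (\<Prod>v\<in>V. \<Prod>e\<in>S. c v ^ of_bool (t e = v)) * (\<Prod>v\<in>V. \<Prod>e\<in>A - S. c v ^ of_bool (h e = v))"
    by (simp only: lookup_selection power_add power_sum prod.distrib)
  also have "\<dots> = (\<Prod>e\<in>S. \<Prod>v\<in>V. c v ^ of_bool (t e = v)) * (\<Prod>e\<in>A - S. \<Prod>v\<in>V. c v ^ of_bool (h e = v))"
    by (intro arg_cong2[where f = "(*)"] prod.swap)
  also have "\<dots> = (\<Prod>e\<in>S. c (t e)) * (\<Prod>e\<in>A - S. c (h e))"
    using assms by (intro arg_cong2[where f = "(*)"] prod.cong point) auto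
  finally show ?thesis .
qed

text \<open>The product of the functionals of \<open>lagrange_weights\<close>, applied to the polynomial evaluated on the grid of
  lists, returns the coefficient of \<open>\<xi>\<close>: every other monomial has the same total degree, hence
  a smaller exponent than \<open>\<xi>\<close> in some variable.\<close>

lemma exists_coloring_of_coefficient_neq_0:
  fixes L :: "'v \<Rightarrow> real set"
  assumes "finite V" "finite A" "t ` A \<subseteq> V" "h ` A \<subseteq> V"
    and coeff: "coefficient (\<Prod>e\<in>A. var (h e) - var (t e)) \<xi> \<noteq> 0"
    and L: "\<And>v. v \<in> V \<Longrightarrow> finite (L v) \<and> card (L v) = Suc (Poly_Mapping.lookup \<xi> v)"
  shows "\<exists>c\<in>PiE V L. \<forall>e\<in>A. c (h e) \<noteq> c (t e)"
proof -
  let ?m = "\<lambda>S. Poly_Mapping.lookup (selection t h A S)"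
  have "\<forall>v\<in>V. \<exists>w. \<forall>j\<le>Poly_Mapping.lookup \<xi> v.
      (\<Sum>a\<in>L v. w a * a ^ j) = of_bool (j = Poly_Mapping.lookup \<xi> v)"
    using lagrange_weights L by blast
  then obtain w where w: "\<And>v j. v \<in> V \<Longrightarrow> j \<le> Poly_Mapping.lookup \<xi> v \<Longrightarrow>
      (\<Sum>a\<in>L v. w v a * a ^ j) = of_bool (j = Poly_Mapping.lookup \<xi> v)"
    by metis
  \<comment> \<open>\<open>S0\<close> exhibits \<open>\<xi>\<close> as the exponent of a selection,
    which gives its total degree and its vanishing outside \<open>V\<close>.\<close>
  obtain S0 where S0: "S0 \<subseteq> A" "selection t h A S0 = \<xi>"
    using sum.not_neutral_contains_not_neutral[OF coeff[unfolded coefficient_prod_var_diff[OF assms(2)]]]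
    by auto
  have factor: "(\<Prod>v\<in>V. \<Sum>a\<in>L v. w v a * a ^ ?m S v) = of_bool (selection t h A S = \<xi>)"
    if "S \<subseteq> A" for S
  proof (cases "selection t h A S = \<xi>")
    case True
    then show ?thesis using w by simp
  next
    case False
    have "\<exists>v\<in>V. ?m S v < Poly_Mapping.lookup \<xi> v"
    proof (rule ccontr)
      assume "\<not> ?thesis"
      then have le: "Poly_Mapping.lookup \<xi> v \<le> ?m S v" if "v \<in> V" for v
        using that by (simp add: not_less)
      have sums: "(\<Sum>v\<in>V. Poly_Mapping.lookup \<xi> v) = (\<Sum>v\<in>V. ?m S v)"
        using sum_lookup_selection[OF assms(2,1) that assms(3,4)]
          sum_lookup_selection[OF assms(2,1) S0(1) assms(3,4)] S0(2) by simp
      have on: "Poly_Mapping.lookup \<xi> v = ?m S v" if "v \<in> V" for v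
        using sum_mono_inv[OF sums le that assms(1)] .
      have off: "?m S v = 0" "Poly_Mapping.lookup \<xi> v = 0" if "v \<notin> V" for v
        using lookup_selection_eq_0[OF \<open>S \<subseteq> A\<close>, of v t h] lookup_selection_eq_0[OF S0(1), of v t h]
          S0(2) that assms(3,4) by auto
      have "selection t h A S = \<xi>"
        by (rule poly_mapping_eqI) (metis on off)
      with False show False by contradiction
    qed
    then obtain v where v: "v \<in> V" "?m S v < Poly_Mapping.lookup \<xi> v" by blast
    then have "(\<Sum>a\<in>L v. w v a * a ^ ?m S v) = 0" using w[of v "?m S v"] by simp
    then show ?thesis using False v(1) assms(1) by (auto intro: prod_zero)
  qed
  have expand: "(\<Prod>e\<in>A. c (h e) - c (t e)) = (\<Sum>S\<in>Pow A. (-1) ^ card S * (\<Prod>v\<in>V. c v ^ ?m S v))"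
    for c :: "'v \<Rightarrow> real"
    unfolding prod_diff_conv_sum[OF assms(2)]
    by (rule sum.cong) (simp_all add: prod_power_selection[OF assms(1) _ assms(3,4)])
  \<comment> \<open>Since the weights form a product over \<open>V\<close>, the grid sum of each
    monomial splits into one moment per vertex. A non-zero total yields a grid point at which no
    edge factor vanishes.\<close>
  have "(\<Sum>c\<in>PiE V L. (\<Prod>v\<in>V. w v (c v)) * (\<Prod>e\<in>A. c (h e) - c (t e)))
      = (\<Sum>c\<in>PiE V L. \<Sum>S\<in>Pow A. (-1) ^ card S * (\<Prod>v\<in>V. w v (c v) * c v ^ ?m S v))"
    unfolding expand by (simp only: sum_distrib_left prod.distrib mult_ac)
  also have "\<dots> = (\<Sum>S\<in>Pow A. \<Sum>c\<in>PiE V L. (-1) ^ card S * (\<Prod>v\<in>V. w v (c v) * c v ^ ?m S v))"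
    by (rule sum.swap)
  also have "\<dots> = (\<Sum>S\<in>Pow A. (-1) ^ card S * (\<Prod>v\<in>V. \<Sum>a\<in>L v. w v a * a ^ ?m S v))"
    using L assms(1) by (subst prod_sum_PiE) (auto simp: sum_distrib_left)
  also have "\<dots> = (\<Sum>S\<in>Pow A. (-1) ^ card S * of_bool (selection t h A S = \<xi>))"
    using factor by (intro sum.cong) auto
  also have "\<dots> = of_int (coefficient (\<Prod>e\<in>A. var (h e) - var (t e)) \<xi>)"
    by (simp add: coefficient_prod_var_diff[OF assms(2)])
  also have "\<dots> \<noteq> 0" using coeff by simp
  finally obtain c where c: "c \<in> PiE V L" "(\<Prod>v\<in>V. w v (c v)) * (\<Prod>e\<in>A. c (h e) - c (t e)) \<noteq> 0"
    by (rule sum.not_neutral_contains_not_neutral)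
  then have "\<forall>e\<in>A. c (h e) \<noteq> c (t e)" using assms(2) by auto
  with c(1) show ?thesis by blast
qed

section \<open>Orientations\<close>

lemma orientation_properties:
  assumes "simple_graph G" "orientation G D"
  shows "D \<subseteq> verts G \<times> verts G" and "\<And>e. e \<in> D \<Longrightarrow> fst e \<noteq> snd e"
proof -
  have "{u, v} \<subseteq> verts G \<and> card {u, v} = 2" if "(u, v) \<in> D" for u v
  proof -
    have "{u, v} \<in> edges G"
      using bij_betw_apply[OF assms(2)[unfolded orientation_def] that] by simp
    then show ?thesis using assms(1) unfolding simple_graph_def by blast
  qed
  then show "D \<subseteq> verts G \<times> verts G" "\<And>e. e \<in> D \<Longrightarrow> fst e \<noteq> snd e"
    by (fastforce simp: card_insert_if split: if_splits)+
qed

lemma orientation_arc_of_edge: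
  assumes "orientation G D" "{u, v} \<in> edges G"
  shows "(u, v) \<in> D \<or> (v, u) \<in> D"
proof -
  have "{u, v} \<in> (\<lambda>(u, v). {u, v}) ` D" using assms by (simp add: orientation_def bij_betw_def)
  then show ?thesis by (auto simp: doubleton_eq_iff)
qed

lemma oriented_poly_conv_fst_snd:
  "oriented_poly D = (\<Prod>e\<in>D. var (snd e) - var (fst e))"
  by (simp add: oriented_poly_def case_prod_beta)

text \<open>Only non-vanishing is ever claimed, so the arbitrary orientation behind
  \<open>graph_poly\<close> may be replaced by a convenient one.\<close>

lemma coefficient_graph_poly_neq_0_iff:
  assumes "simple_graph G" "orientation G D"
  shows "coefficient (graph_poly G) \<xi> \<noteq> 0 \<longleftrightarrow> coefficient (oriented_poly D) \<xi> \<noteq> 0"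
  using graph_poly_up_to_sign[OF assms] by (auto simp: coefficient_def)

text \<open>Arcs are loop-free, so at most one of the two indicators is 1 and counting arc ends at
  \<open>v\<close> counts edges.\<close>

lemma degree_conv_arcs:
  assumes "simple_graph G" "orientation G D" "finite D"
  shows "degree G v = (\<Sum>e\<in>D. of_bool (fst e = v) + of_bool (snd e = v))"
proof -
  have "(\<lambda>(u, v). {u, v}) ` {e \<in> D. fst e = v \<or> snd e = v} = {e \<in> edges G. v \<in> e}"
    unfolding bij_betw_imp_surj_on[OF assms(2)[unfolded orientation_def], symmetric] by force
  then have "bij_betw (\<lambda>(u, v). {u, v}) {e \<in> D. fst e = v \<or> snd e = v} {e \<in> edges G. v \<in> e}"
    by (intro bij_betw_subset[OF assms(2)[unfolded orientation_def]]) auto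
  then have "degree G v = card {e \<in> D. fst e = v \<or> snd e = v}"
    unfolding degree_def by (simp add: bij_betw_same_card)
  also have "\<dots> = (\<Sum>e\<in>D. if fst e = v \<or> snd e = v then 1 else 0)"
    using assms(3) by (simp add: sum.If_cases Int_def)
  also have "\<dots> = (\<Sum>e\<in>D. of_bool (fst e = v) + of_bool (snd e = v))"
  proof (rule sum.cong)
    fix e assume "e \<in> D"
    from orientation_properties(2)[OF assms(1,2) this]
    show "(if fst e = v \<or> snd e = v then 1 else 0 :: nat) = of_bool (fst e = v) + of_bool (snd e = v)"
      by (cases "fst e = v"; cases "snd e = v") simp_all
  qed simp
  finally show ?thesis .
qed

lemma choosable_of_coefficient_neq_0:
  assumes "simple_graph G" "finite (verts G)" "coefficient (graph_poly G) \<xi> \<noteq> 0"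
  shows "choosable G (\<lambda>v. Poly_Mapping.lookup \<xi> v + 1)"
  unfolding choosable_def
proof (intro allI impI)
  fix L :: "'a \<Rightarrow> nat set"
  assume L: "\<forall>v\<in>verts G. finite (L v) \<and> Poly_Mapping.lookup \<xi> v + 1 \<le> card (L v)"
  obtain D where D: "orientation G D" using orientation_exists[OF assms(1)] by blast
  note DV = orientation_properties(1)[OF assms(1) D]
  have fin: "finite D" using DV assms(2) finite_subset by blast
  \<comment> \<open>The divided differences need lists of size exactly one more than the exponent,
    so longer lists are cut down.\<close>
  have "\<forall>v\<in>verts G. \<exists>K. K \<subseteq> L v \<and> card K = Suc (Poly_Mapping.lookup \<xi> v)"
    using L obtain_subset_with_card_n by (metis Suc_eq_plus1)
  then obtain K where K: "\<And>v. v \<in> verts G \<Longrightarrow> K v \<subseteq> L v \<and> card (K v) = Suc (Poly_Mapping.lookup \<xi> v)"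
    by metis
  \<comment> \<open>Colors are moved into the reals because the weights involve division;
    \<open>nat\<close> of the floor brings them back.\<close>
  have "\<exists>c\<in>PiE (verts G) (\<lambda>v. real ` K v). \<forall>e\<in>D. c (snd e) \<noteq> c (fst e)"
  proof (rule exists_coloring_of_coefficient_neq_0)
    show "coefficient (\<Prod>e\<in>D. var (snd e) - var (fst e)) \<xi> \<noteq> 0"
      using assms(3) coefficient_graph_poly_neq_0_iff[OF assms(1) D]
      by (simp add: oriented_poly_conv_fst_snd)
    show "finite (real ` K v) \<and> card (real ` K v) = Suc (Poly_Mapping.lookup \<xi> v)"
      if "v \<in> verts G" for v
      using K[OF that] card_ge_0_finite[of "K v"] by (simp add: card_image inj_on_def)
  qed (use DV fin assms(2) in auto)
  then obtain c where c: "c \<in> PiE (verts G) (\<lambda>v. real ` K v)" "\<And>e. e \<in> D \<Longrightarrow> c (snd e) \<noteq> c (fst e)"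
    by blast
  have col: "nat \<lfloor>c v\<rfloor> \<in> K v \<and> real (nat \<lfloor>c v\<rfloor>) = c v" if "v \<in> verts G" for v
    using PiE_mem[OF c(1) that] by auto
  have "nat \<lfloor>c u\<rfloor> \<noteq> nat \<lfloor>c v\<rfloor>" if "{u, v} \<in> edges G" for u v
  proof -
    have arc: "(u, v) \<in> D \<or> (v, u) \<in> D" by (rule orientation_arc_of_edge[OF D that])
    then have "c u \<noteq> c v" using c(2) by fastforce
    moreover have "u \<in> verts G" "v \<in> verts G" using arc DV by auto
    ultimately show ?thesis using col by metis
  qed
  then have "proper_coloring G (\<lambda>v. nat \<lfloor>c v\<rfloor>)" by (simp add: proper_coloring_def)
  moreover have "\<forall>v\<in>verts G. nat \<lfloor>c v\<rfloor> \<in> L v" using col K by blast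
  ultimately show "\<exists>c. (\<forall>v\<in>verts G. c v \<in> L v) \<and> proper_coloring G c"
    by (intro exI[of _ "\<lambda>v. nat \<lfloor>c v\<rfloor>"]) simp
qed

section \<open>Comparing the choice number with the Alon-Tarsi number\<close>

lemma choosable_mono:
  assumes "choosable G f" "\<And>v. v \<in> verts G \<Longrightarrow> f v \<le> g v"
  shows "choosable G g"
  unfolding choosable_def
proof (intro allI impI)
  fix L :: "'a \<Rightarrow> nat set"
  assume "\<forall>v\<in>verts G. finite (L v) \<and> g v \<le> card (L v)"
  then have "\<forall>v\<in>verts G. finite (L v) \<and> f v \<le> card (L v)"
    using assms(2) order_trans by blast
  then show "\<exists>c. (\<forall>v\<in>verts G. c v \<in> L v) \<and> proper_coloring G c"
    using assms(1) unfolding choosable_def by blast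
qed

text \<open>The third assumption ensures that the \<open>LEAST\<close> defining the Alon-Tarsi
  number is attained by some exponent \<open>d\<close>. The positivity demanded by
  \<open>choice_number\<close> comes from the \<open>+ 1\<close> after \<open>Max\<close>.\<close>

lemma choice_number_le_alon_tarsi_number:
  assumes "simple_graph G" "finite (verts G)"
    and "\<exists>d. Poly_Mapping.keys d \<subseteq> verts G \<and> coefficient (graph_poly G) d \<noteq> 0"
  shows "choice_number G \<le> alon_tarsi_number G"
proof -
  let ?P = "\<lambda>k. \<exists>d. Poly_Mapping.keys d \<subseteq> verts G \<and>
       k = Max (Poly_Mapping.lookup d ` verts G) + 1 \<and> coefficient (graph_poly G) d \<noteq> 0"
  have "\<exists>k. ?P k" using assms(3) by blast
  then have "?P (alon_tarsi_number G)" unfolding alon_tarsi_number_def by (rule LeastI_ex)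
  then obtain d where d: "alon_tarsi_number G = Max (Poly_Mapping.lookup d ` verts G) + 1"
    "coefficient (graph_poly G) d \<noteq> 0" by blast
  have "choosable G (\<lambda>_. alon_tarsi_number G)"
    by (rule choosable_mono[OF choosable_of_coefficient_neq_0[OF assms(1,2) d(2)]])
       (use assms(2) d(1) in auto)
  then show ?thesis unfolding choice_number_def using d(1) by (intro Least_le) auto
qed

section \<open>The product with a cycle\<close>

text \<open>Images of index pairs, with the shift of \<open>cylinder_poly\<close>: injectivity and
  disjointness of the two parts turn sums and products over arcs into double ones over
  indices.\<close>

definition cylinder_arcs :: "('a \<times> 'a) set \<Rightarrow> 'a set \<Rightarrow> nat \<Rightarrow> (('a \<times> nat) \<times> ('a \<times> nat)) set" where
  "cylinder_arcs D V m =
     (\<lambda>(i, e). ((fst e, Suc i mod m), (snd e, Suc i mod m))) ` ({..<m} \<times> D) \<union>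
     (\<lambda>(i, v). ((v, i), (v, Suc i mod m))) ` ({..<m} \<times> V)"

lemma Suc_mod_eq_iff:
  "i < m \<Longrightarrow> j < m \<Longrightarrow> Suc i mod m = Suc j mod m \<longleftrightarrow> i = j"
  by (auto simp: mod_Suc split: if_splits)

lemma inj_on_layers:
  "inj_on (\<lambda>(i, e). ((fst e, Suc i mod m), (snd e, Suc i mod m))) ({..<m} \<times> D)"
  by (auto intro!: inj_onI simp: Suc_mod_eq_iff)

lemma inj_on_rungs:
  "inj_on (\<lambda>(i, v). ((v, i), (v, Suc i mod m))) ({..<m} \<times> V)"
  by (auto intro!: inj_onI)

lemma finite_cylinder_arcs: "finite D \<Longrightarrow> finite V \<Longrightarrow> finite (cylinder_arcs D V m)"
  by (simp add: cylinder_arcs_def)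

text \<open>Along a rung the first coordinate is constant, along a layer arc it changes.\<close>

lemma layers_rungs_disjoint:
  assumes "\<And>e. e \<in> D \<Longrightarrow> fst e \<noteq> snd e"
  shows "(\<lambda>(i, e). ((fst e, Suc i mod m), (snd e, Suc i mod m))) ` ({..<m} \<times> D) \<inter>
     (\<lambda>(i, v). ((v, i), (v, Suc i mod m))) ` ({..<m} \<times> V) = {}"
  using assms by fastforce

lemma oriented_poly_cylinder_arcs:
  assumes "finite D" "finite V" "\<And>e. e \<in> D \<Longrightarrow> fst e \<noteq> snd e"
  shows "oriented_poly (cylinder_arcs D V m) = cylinder_poly D V m"
proof -
  have "(\<Prod>a\<in>(\<lambda>(i, e). ((fst e, Suc i mod m), (snd e, Suc i mod m))) ` ({..<m} \<times> D).
        var (snd a) - var (fst a))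
      = (\<Prod>i<m. \<Prod>e\<in>D. var (snd e, Suc i mod m) - var (fst e, Suc i mod m))"
    by (subst prod.reindex[OF inj_on_layers]) (simp add: prod.cartesian_product case_prod_unfold)
  moreover have "(\<Prod>a\<in>(\<lambda>(i, v). ((v, i), (v, Suc i mod m))) ` ({..<m} \<times> V). var (snd a) - var (fst a))
      = (\<Prod>i<m. \<Prod>v\<in>V. var (v, Suc i mod m) - var (v, i))"
    by (subst prod.reindex[OF inj_on_rungs]) (simp add: prod.cartesian_product case_prod_unfold)
  ultimately show ?thesis
    unfolding oriented_poly_conv_fst_snd cylinder_arcs_def cylinder_poly_def
    by (subst prod.union_disjoint[OF _ _ layers_rungs_disjoint[OF assms(3)]]) (simp_all add: assms(1,2))
qed

lemma sum_cylinder_arcs: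
  assumes "finite D" "finite V" "\<And>e. e \<in> D \<Longrightarrow> fst e \<noteq> snd e"
  shows "(\<Sum>a\<in>cylinder_arcs D V m. f a)
     = (\<Sum>i<m. \<Sum>e\<in>D. f ((fst e, Suc i mod m), (snd e, Suc i mod m)))
     + (\<Sum>i<m. \<Sum>v\<in>V. f ((v, i), (v, Suc i mod m)) :: nat)"
proof -
  have "(\<Sum>a\<in>(\<lambda>(i, e). ((fst e, Suc i mod m), (snd e, Suc i mod m))) ` ({..<m} \<times> D). f a)
      = (\<Sum>i<m. \<Sum>e\<in>D. f ((fst e, Suc i mod m), (snd e, Suc i mod m)))"
    by (subst sum.reindex[OF inj_on_layers]) (simp add: sum.cartesian_product case_prod_unfold)
  moreover have "(\<Sum>a\<in>(\<lambda>(i, v). ((v, i), (v, Suc i mod m))) ` ({..<m} \<times> V). f a)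
      = (\<Sum>i<m. \<Sum>v\<in>V. f ((v, i), (v, Suc i mod m)))"
    by (subst sum.reindex[OF inj_on_rungs]) (simp add: sum.cartesian_product case_prod_unfold)
  ultimately show ?thesis
    unfolding cylinder_arcs_def
    by (subst sum.union_disjoint[OF _ _ layers_rungs_disjoint[OF assms(3)]]) (simp_all add: assms(1,2))
qed

section \<open>Layers and rungs as an orientation of the product\<close>

lemma edges_cartesian_product_cycle:
  assumes "simple_graph G" "m > 0"
  shows "edges (cartesian_product G (cycle_graph m)) =
    {{(u, i), (v, i)} | u v i. i < m \<and> {u, v} \<in> edges G} \<union>
    {{(v, i), (v, Suc i mod m)} | v i. i < m \<and> v \<in> verts G}" (is "?E = ?L \<union> ?R")
proof
  have cycle: "verts (cycle_graph m) = {..<m}"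
    "e \<in> edges (cycle_graph m) \<longleftrightarrow> (\<exists>i<m. e = {i, Suc i mod m})" for e
    by (auto simp: cycle_graph_def)
  have edge_iff: "x \<in> ?E \<longleftrightarrow> (\<exists>v1 v2 u1 u2. x = {(v1, v2), (u1, u2)} \<and>
      v1 \<in> verts G \<and> u1 \<in> verts G \<and> v2 \<in> verts (cycle_graph m) \<and> u2 \<in> verts (cycle_graph m) \<and>
      (v1 = u1 \<and> {v2, u2} \<in> edges (cycle_graph m) \<or> v2 = u2 \<and> {v1, u1} \<in> edges G))" for x
    by (simp only: cartesian_product_def graph.select_convs mem_Collect_eq)
  show "?E \<subseteq> ?L \<union> ?R"
  proof
    fix x assume "x \<in> ?E"
    then obtain v1 v2 u1 u2 where x: "x = {(v1, v2), (u1, u2)}" "v1 \<in> verts G" "v2 < m"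
      and cases: "v1 = u1 \<and> {v2, u2} \<in> edges (cycle_graph m) \<or> v2 = u2 \<and> {v1, u1} \<in> edges G"
      unfolding edge_iff cycle(1) lessThan_iff by (elim exE conjE) blast
    from cases show "x \<in> ?L \<union> ?R"
    proof
      assume "v1 = u1 \<and> {v2, u2} \<in> edges (cycle_graph m)"
      then obtain i where i: "v1 = u1" "i < m" "{v2, u2} = {i, Suc i mod m}" unfolding cycle by blast
      \<comment> \<open>Written as an image of the cycle edge, \<open>x\<close> does not depend on
        which end is called \<open>v2\<close>.\<close>
      have "x = Pair v1 ` {v2, u2}" using x(1) i(1) by simp
      then have "x = {(v1, i), (v1, Suc i mod m)}" unfolding i(3) by simp
      then show ?thesis using i(2) x(2) by blast
    next
      assume "v2 = u2 \<and> {v1, u1} \<in> edges G"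
      then show ?thesis using x by blast
    qed
  qed
  show "?L \<union> ?R \<subseteq> ?E"
  proof (intro Un_least subsetI)
    fix x assume "x \<in> ?L"
    then obtain u v i where x: "x = {(u, i), (v, i)}" "i < m" "{u, v} \<in> edges G" by blast
    moreover have "{u, v} \<subseteq> verts G" using x(3) assms(1) unfolding simple_graph_def by blast
    ultimately show "x \<in> ?E" unfolding edge_iff cycle(1)
      by (intro exI[of _ u] exI[of _ i] exI[of _ v] exI[of _ i]) simp
  next
    fix x assume "x \<in> ?R"
    then obtain v i where "x = {(v, i), (v, Suc i mod m)}" "i < m" "v \<in> verts G" by blast
    then show "x \<in> ?E" unfolding edge_iff cycle using assms(2)
      by (intro exI[of _ v] exI[of _ i] exI[of _ v] exI[of _ "Suc i mod m"]) auto
  qed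
qed

lemma simple_graph_cartesian_product_cycle:
  assumes "simple_graph G" "m \<ge> 2"
  shows "simple_graph (cartesian_product G (cycle_graph m))"
  unfolding simple_graph_def
proof
  have verts: "verts (cartesian_product G (cycle_graph m)) = verts G \<times> {..<m}"
    by (simp add: cartesian_product_def cycle_graph_def)
  have "m > 0" using assms(2) by simp
  fix e assume "e \<in> edges (cartesian_product G (cycle_graph m))"
  then consider (layer) u v i where "i < m" "{u, v} \<in> edges G" "e = {(u, i), (v, i)}"
    | (rung) v i where "i < m" "v \<in> verts G" "e = {(v, i), (v, Suc i mod m)}"
    unfolding edges_cartesian_product_cycle[OF assms(1) \<open>m > 0\<close>] by blast
  then show "e \<subseteq> verts (cartesian_product G (cycle_graph m)) \<and> card e = 2"
  proof cases
    case layer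
    then have "{u, v} \<subseteq> verts G" "card {u, v} = 2" using assms(1) unfolding simple_graph_def by blast+
    moreover from this(2) have "u \<noteq> v" by auto
    ultimately show ?thesis using layer by (simp add: verts)
  next
    case rung
    moreover have "i \<noteq> Suc i mod m" using rung(1) assms(2) by (auto simp: mod_Suc)
    ultimately show ?thesis by (simp add: verts)
  qed
qed

lemma image_cylinder_arcs:
  assumes G: "simple_graph G" and D: "orientation G D" and m: "m > 0"
  shows "(\<lambda>(u, v). {u, v}) ` cylinder_arcs D (verts G) m = edges (cartesian_product G (cycle_graph m))"
    (is "?h ` _ = _")
proof -
  have edges_G: "edges G = (\<lambda>(u, v). {u, v}) ` D"
    using bij_betw_imp_surj_on[OF D[unfolded orientation_def]] by simp
  have "?h ` cylinder_arcs D (verts G) m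
      = {{(fst e, Suc i mod m), (snd e, Suc i mod m)} | e i. i < m \<and> e \<in> D}
      \<union> {{(v, i), (v, Suc i mod m)} | v i. i < m \<and> v \<in> verts G}"
    unfolding cylinder_arcs_def image_Un by (intro arg_cong2[where f = "(\<union>)"]) force+
  \<comment> \<open>The shift of the layer index only permutes the heights.\<close>
  also have "{{(fst e, Suc i mod m), (snd e, Suc i mod m)} | e i. i < m \<and> e \<in> D}
      = {{(fst e, i), (snd e, i)} | e i. i \<in> (\<lambda>i. Suc i mod m) ` {..<m} \<and> e \<in> D}"
    by blast
  also have "\<dots> = {{(fst e, i), (snd e, i)} | e i. i < m \<and> e \<in> D}"
    unfolding bij_betw_imp_surj_on[OF bij_betw_Suc_mod[OF m]] by simp
  also have "\<dots> = {{(u, i), (v, i)} | u v i. i < m \<and> {u, v} \<in> edges G}" (is "?A = ?B")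
  proof
    show "?A \<subseteq> ?B" unfolding edges_G by fastforce
    show "?B \<subseteq> ?A"
    proof
      fix x assume "x \<in> ?B"
      then obtain u v i where x: "x = {(u, i), (v, i)}" "i < m" "{u, v} \<in> edges G" by blast
      from orientation_arc_of_edge[OF D x(3)] show "x \<in> ?A"
      proof
        assume "(u, v) \<in> D"
        then show ?thesis using x(1,2) by force
      next
        assume "(v, u) \<in> D"
        moreover have "x = {(fst (v, u), i), (snd (v, u), i)}" using x(1) by (simp add: insert_commute)
        ultimately show ?thesis using x(2) by blast
      qed
    qed
  qed
  finally show ?thesis unfolding edges_cartesian_product_cycle[OF G m] .
qed

text \<open>Here \<open>m \<ge> 3\<close> is essential: for \<open>m = 2\<close> the two rungs over
  a vertex would join the same two points in opposite directions and give a single edge.\<close>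

lemma orientation_cylinder_arcs:
  assumes G: "simple_graph G" and D: "orientation G D" and m: "m \<ge> 3"
  shows "orientation (cartesian_product G (cycle_graph m)) (cylinder_arcs D (verts G) m)"
proof -
  let ?h = "\<lambda>(u, v). {u, v}"
  note loopfree = orientation_properties(2)[OF G D]
  have injD: "e = e'" if "e \<in> D" "e' \<in> D" "{fst e, snd e} = {fst e', snd e'}" for e e'
    using inj_onD[OF bij_betw_imp_inj_on[OF D[unfolded orientation_def]], of e e'] that
    by (simp add: case_prod_beta)
  have layer: "i = j \<and> e = e'"
    if "i < m" "j < m" "e \<in> D" "e' \<in> D"
      "{(fst e, Suc i mod m), (snd e, Suc i mod m)} = {(fst e', Suc j mod m), (snd e', Suc j mod m)}"
    for i j e e'
  proof -
    from that(5) have "Suc i mod m = Suc j mod m" "{fst e, snd e} = {fst e', snd e'}"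
      by (auto simp: doubleton_eq_iff)
    then show ?thesis using injD that Suc_mod_eq_iff by blast
  qed
  have rung: "i = j \<and> v = w"
    if "i < m" "j < m" "{(v, i), (v, Suc i mod m)} = {(w, j), (w, Suc j mod m)}" for i j v w
    using that m by (auto simp: doubleton_eq_iff mod_Suc split: if_splits)
  have mixed: False
    if "e \<in> D" "{(fst e, i), (snd e, i)} = {(w, j), (w, j')}" for e i w j j'
    using loopfree[OF that(1)] that(2) by (auto simp: doubleton_eq_iff)
  have "inj_on ?h (cylinder_arcs D (verts G) m)"
  proof (rule inj_onI)
    fix a b
    assume a: "a \<in> cylinder_arcs D (verts G) m" and b: "b \<in> cylinder_arcs D (verts G) m"
      and eq: "?h a = ?h b"
    consider (L) i e where "i < m" "e \<in> D" "a = ((fst e, Suc i mod m), (snd e, Suc i mod m))"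
      | (R) i v where "i < m" "a = ((v, i), (v, Suc i mod m))"
      using a by (auto simp: cylinder_arcs_def)
    note a_cases = this
    consider (L') j e' where "j < m" "e' \<in> D" "b = ((fst e', Suc j mod m), (snd e', Suc j mod m))"
      | (R') j w where "j < m" "b = ((w, j), (w, Suc j mod m))"
      using b by (auto simp: cylinder_arcs_def)
    note b_cases = this
    from a_cases show "a = b"
    proof cases
      case L
      note a = L
      from b_cases show ?thesis
      proof cases
        case L'
        then show ?thesis using layer[OF a(1) L'(1) a(2) L'(2)] a eq by simp
      next
        case R'
        then have "{(fst e, Suc i mod m), (snd e, Suc i mod m)} = {(w, j), (w, Suc j mod m)}"
          using a eq by simp
        then show ?thesis by (rule FalseE[OF mixed[OF a(2)]])
      qed
    next
      case R
      note a = R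
      from b_cases show ?thesis
      proof cases
        case L'
        then have "{(fst e', Suc j mod m), (snd e', Suc j mod m)} = {(v, i), (v, Suc i mod m)}"
          using a eq by simp
        then show ?thesis by (rule FalseE[OF mixed[OF L'(2)]])
      next
        case R'
        then show ?thesis using rung[OF a(1) R'(1), of v w] a eq by simp
      qed
    qed
  qed
  then show ?thesis
    using image_cylinder_arcs[OF G D] m by (simp add: orientation_def bij_betw_def)
qed

section \<open>Degrees in the product\<close>

lemma degree_cartesian_product_cycle:
  assumes G: "simple_graph G" and fin: "finite (verts G)" and m: "m \<ge> 3"
    and v: "v \<in> verts G" and j: "j < m"
  shows "degree (cartesian_product G (cycle_graph m)) (v, j) = degree G v + 2"
proof -
  obtain D where D: "orientation G D" using orientation_exists[OF G] by blast
  note DV = orientation_properties[OF G D]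
  have finD: "finite D" using DV(1) fin finite_subset by blast
  \<comment> \<open>\<open>i\<close> is the index both of the layer at height \<open>j\<close> and
    of the rung ending there; the rung of index \<open>j\<close> starts there.\<close>
  obtain i where i: "i < m" "j = Suc i mod m"
    using bij_betw_Suc_mod[of m] j by (auto simp: bij_betw_def)
  have layers: "(\<Sum>l<m. \<Sum>e\<in>D. of_bool ((fst e, Suc l mod m) = (v, j)) + of_bool ((snd e, Suc l mod m) = (v, j)))
      = degree G v"
  proof -
    have "(\<Sum>l<m. \<Sum>e\<in>D. of_bool ((fst e, Suc l mod m) = (v, j)) + of_bool ((snd e, Suc l mod m) = (v, j)))
        = (\<Sum>l<m. if l = i then degree G v else 0)"
      using i by (intro sum.cong) (auto simp: Suc_mod_eq_iff degree_conv_arcs[OF G D finD])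
    then show ?thesis using i(1) by simp
  qed
  have rungs: "(\<Sum>l<m. \<Sum>w\<in>verts G. of_bool ((w, l) = (v, j)) + of_bool ((w, Suc l mod m) = (v, j))) = (2 :: nat)"
  proof -
    have "(\<Sum>l<m. \<Sum>w\<in>verts G. of_bool ((w, l) = (v, j)) + of_bool ((w, Suc l mod m) = (v, j)))
        = (\<Sum>l<m. (if l = j then 1 else 0) + (if l = i then 1 else 0 :: nat))"
      using v i(2) Suc_mod_eq_iff[OF _ i(1)]
      by (intro sum.cong) (simp_all only: sum.distrib sum_of_bool_pair[OF fin], auto)
    then show ?thesis using i(1) j by (simp add: sum.distrib)
  qed
  have "m \<ge> 2" using m by simp
  have "degree (cartesian_product G (cycle_graph m)) (v, j) = (\<Sum>a\<in>cylinder_arcs D (verts G) m.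
      of_bool (fst a = (v, j)) + of_bool (snd a = (v, j)))"
    by (rule degree_conv_arcs[OF simple_graph_cartesian_product_cycle[OF G \<open>m \<ge> 2\<close>]
        orientation_cylinder_arcs[OF G D m] finite_cylinder_arcs[OF finD fin]])
  also have "\<dots> = degree G v + 2"
  proof (subst sum_cylinder_arcs[OF finD fin])
    show "fst e \<noteq> snd e" if "e \<in> D" for e using DV(2)[OF that] .
  qed (simp only: fst_conv snd_conv layers rungs)
  finally show ?thesis .
qed

lemma max_degree_cartesian_product_cycle:
  assumes G: "simple_graph G" and fin: "finite (verts G)" and "verts G \<noteq> {}" and m: "m \<ge> 3"
  shows "max_degree (cartesian_product G (cycle_graph m)) = max_degree G + 2"
proof -
  have "degree (cartesian_product G (cycle_graph m)) ` verts (cartesian_product G (cycle_graph m))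
      = (\<lambda>x. degree (cartesian_product G (cycle_graph m)) x) ` (verts G \<times> {..<m})"
    by (simp add: cartesian_product_def cycle_graph_def)
  also have "\<dots> = (\<lambda>x. degree G (fst x) + 2) ` (verts G \<times> {..<m})"
    using degree_cartesian_product_cycle[OF G fin m] by (intro image_cong) auto
  also have "\<dots> = (\<lambda>n. n + 2) ` degree G ` fst ` (verts G \<times> {..<m})"
    by (simp only: image_image)
  also have "fst ` (verts G \<times> {..<m}) = verts G" using m by (simp add: fst_image_times lessThan_empty_iff)
  finally have image: "degree (cartesian_product G (cycle_graph m)) ` verts (cartesian_product G (cycle_graph m))
      = (\<lambda>n. n + 2) ` degree G ` verts G" .
  show ?thesis
    unfolding max_degree_def image using assms(2,3)
    by (intro mono_Max_commute[symmetric]) (auto simp: mono_def)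
qed

text \<open>An exponent within distance 1 of \<open>d\<close> is \<open>d\<close> plus the indicator
  of where it lies above minus the indicator of where it lies below. These two disjoint sets name a
  matrix entry equal to the given coefficient.\<close>

lemma coefficient_oriented_poly_conv_transfer:
  assumes "finite V" "D \<subseteq> V \<times> V" "Poly_Mapping.keys \<xi> \<subseteq> V"
    and near: "\<And>v. v \<in> V \<Longrightarrow> d v \<le> Poly_Mapping.lookup \<xi> v + 1 \<and> Poly_Mapping.lookup \<xi> v \<le> d v + 1"
  shows "coefficient (oriented_poly D) \<xi>
    = transfer D V d {v \<in> V. d v < Poly_Mapping.lookup \<xi> v} {v \<in> V. Poly_Mapping.lookup \<xi> v < d v}"
proof -
  have finD: "finite D" using finite_subset[OF assms(2)] assms(1) by blast
  have "selection fst snd D S = \<xi> \<longleftrightarrow>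
      (\<forall>v\<in>V. Poly_Mapping.lookup (selection fst snd D S) v
        + of_bool (v \<in> {v \<in> V. Poly_Mapping.lookup \<xi> v < d v})
       = d v + of_bool (v \<in> {v \<in> V. d v < Poly_Mapping.lookup \<xi> v}))" (is "_ \<longleftrightarrow> ?R")
    if "S \<subseteq> D" for S
  proof -
    have off: "Poly_Mapping.lookup (selection fst snd D S) v = Poly_Mapping.lookup \<xi> v" if "v \<notin> V" for v
    proof -
      have "v \<notin> fst ` D" "v \<notin> snd ` D" "v \<notin> Poly_Mapping.keys \<xi>" using that assms(2,3) by auto
      then show ?thesis using lookup_selection_eq_0[OF \<open>S \<subseteq> D\<close>, of v fst snd]
        by (simp add: in_keys_iff)
    qed
    have "selection fst snd D S = \<xi> \<longleftrightarrow>
        (\<forall>v\<in>V. Poly_Mapping.lookup (selection fst snd D S) v = Poly_Mapping.lookup \<xi> v)" (is "_ \<longleftrightarrow> ?Q")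
    proof
      assume ?Q
      with off show "selection fst snd D S = \<xi>" by (intro poly_mapping_eqI) blast
    qed simp
    also have "\<dots> \<longleftrightarrow> ?R"
    proof (rule ball_cong)
      fix v assume "v \<in> V"
      from near[OF this] this
      show "Poly_Mapping.lookup (selection fst snd D S) v = Poly_Mapping.lookup \<xi> v \<longleftrightarrow>
        Poly_Mapping.lookup (selection fst snd D S) v
        + of_bool (v \<in> {v \<in> V. Poly_Mapping.lookup \<xi> v < d v})
       = d v + of_bool (v \<in> {v \<in> V. d v < Poly_Mapping.lookup \<xi> v})"
        by (cases "Poly_Mapping.lookup \<xi> v" "d v" rule: linorder_cases) auto
    qed simp
    finally show ?thesis .
  qed
  then show ?thesis
    unfolding oriented_poly_conv_fst_snd coefficient_prod_var_diff[OF finD] transfer_def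
    by (intro sum.cong) simp_all
qed

theorem theorem3:
  fixes G :: "'a graph" and k :: nat and H :: "('a \<times> nat) graph"
  assumes "simple_graph G" and "finite (verts G)" and "verts G \<noteq> {}"
    and "\<forall>v\<in>verts G. even (degree G v)"
    and "\<exists>\<xi>. almost_central G \<xi> \<and> coefficient (graph_poly G) \<xi> \<noteq> 0"
    and "k \<ge> 2"
    and "H = cartesian_product G (cycle_graph (2 * k))"
  shows "(\<exists>\<xi>. central H \<xi> \<and> coefficient (graph_poly H) \<xi> \<noteq> 0) \<and>
    choosable H (\<lambda>v. degree H v div 2 + 1) \<and>
    choice_number H \<le> alon_tarsi_number H \<and>
    real (alon_tarsi_number H) \<le> real (max_degree H) / 2 + 1 \<and>
    real (max_degree H) / 2 + 1 = real (max_degree G) / 2 + 2"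
proof -
  obtain D where D: "orientation G D" using orientation_exists[OF assms(1)] by blast
  note DV = orientation_properties[OF assms(1) D]
  have finD: "finite D" using DV(1) assms(2) finite_subset by blast
  \<comment> \<open>Length at least 3 keeps the rungs over a vertex distinct as edges.\<close>
  have m: "2 * k \<ge> 3" "2 * k \<ge> 2" "0 < k" using assms(6) by auto
  define d where "d = (\<lambda>v. degree G v div 2)"
  have twice_d: "degree G v = 2 * d v" if "v \<in> verts G" for v
    using assms(4) that by (simp add: d_def)
  interpret balanced_arcs D "verts G" d
  proof
    show "(\<Sum>e\<in>D. of_bool (fst e = v) + of_bool (snd e = v)) = 2 * d v" if "v \<in> verts G" for v
      using degree_conv_arcs[OF assms(1) D finD, of v] twice_d[OF that] by simp
  qed (fact assms(2) DV(1))+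
  have H: "simple_graph H"
    unfolding assms(7) by (rule simple_graph_cartesian_product_cycle[OF assms(1) m(2)])
  have verts_H: "verts H = verts G \<times> {..<2 * k}"
    by (simp add: assms(7) cartesian_product_def cycle_graph_def)
  then have fin_H: "finite (verts H)" "verts H \<noteq> {}" using assms(2,3) m(3)
    by (simp_all add: lessThan_empty_iff)
  have degree_H: "degree H x = 2 * (d (fst x) + 1)" if "x \<in> verts H" for x
    using that degree_cartesian_product_cycle[OF assms(1,2) m(1), of "fst x" "snd x"]
      twice_d[of "fst x"] by (auto simp: verts_H assms(7)[symmetric])
  let ?\<zeta> = "central_exponent (2 * k)"

  obtain \<xi> where \<xi>: "almost_central G \<xi>" "coefficient (graph_poly G) \<xi> \<noteq> 0"
    using assms(5) by blast
  have "d v \<le> Poly_Mapping.lookup \<xi> v + 1 \<and> Poly_Mapping.lookup \<xi> v \<le> d v + 1" if "v \<in> verts G" for v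
  proof -
    have "\<bar>real (Poly_Mapping.lookup \<xi> v) - real (d v)\<bar> \<le> 1"
      using \<xi>(1) that twice_d[OF that] by (auto simp: almost_central_def)
    then show ?thesis by linarith
  qed
  then have "coefficient (oriented_poly D) \<xi>
    = transfer D (verts G) d {v \<in> verts G. d v < Poly_Mapping.lookup \<xi> v}
        {v \<in> verts G. Poly_Mapping.lookup \<xi> v < d v}"
    using \<xi>(1) DV(1) assms(2)
    by (intro coefficient_oriented_poly_conv_transfer) (auto simp: almost_central_def)
  then have "coefficient (cylinder_poly D (verts G) (2 * k)) ?\<zeta> \<noteq> 0"
    using \<xi>(2) coefficient_graph_poly_neq_0_iff[OF assms(1) D]
    by (intro central_coefficient_neq_0[OF m(3)]) auto
  then have coeff: "coefficient (graph_poly H) ?\<zeta> \<noteq> 0"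
    using coefficient_graph_poly_neq_0_iff[OF H]
      orientation_cylinder_arcs[OF assms(1) D m(1)] oriented_poly_cylinder_arcs[OF finD assms(2) DV(2)]
    by (simp add: assms(7))

  have lookup_\<zeta>: "Poly_Mapping.lookup ?\<zeta> x = degree H x div 2" if "x \<in> verts H" for x
    using degree_H[OF that] that by (simp add: lookup_central_exponent verts_H)
  have keys_\<zeta>: "Poly_Mapping.keys ?\<zeta> \<subseteq> verts H"
    by (auto simp: verts_H in_keys_iff lookup_central_exponent split: if_splits)
  have central: "central H ?\<zeta>"
    unfolding central_def using keys_\<zeta> lookup_\<zeta> degree_H by simp
  have choosable: "choosable H (\<lambda>v. degree H v div 2 + 1)"
    by (rule choosable_mono[OF choosable_of_coefficient_neq_0[OF H fin_H(1) coeff]]) (simp add: lookup_\<zeta>)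
  have ch: "choice_number H \<le> alon_tarsi_number H"
    using keys_\<zeta> coeff by (intro choice_number_le_alon_tarsi_number[OF H fin_H(1)]) blast
  have "alon_tarsi_number H \<le> Max (Poly_Mapping.lookup ?\<zeta> ` verts H) + 1"
    unfolding alon_tarsi_number_def using keys_\<zeta> coeff by (intro Least_le) blast
  \<comment> \<open>The maximum is attained because the vertex set is finite and non-empty, so it is
    half of an actual degree.\<close>
  moreover have "Max (Poly_Mapping.lookup ?\<zeta> ` verts H) \<in> Poly_Mapping.lookup ?\<zeta> ` verts H"
    using fin_H by (intro Max_in) auto
  then obtain x where x: "x \<in> verts H" "Max (Poly_Mapping.lookup ?\<zeta> ` verts H) = Poly_Mapping.lookup ?\<zeta> x"
    by blast
  moreover have "degree H x \<le> max_degree H"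
    unfolding max_degree_def using fin_H x(1) by simp
  ultimately have AT: "real (alon_tarsi_number H) \<le> real (max_degree H) / 2 + 1"
    using lookup_\<zeta>[OF x(1)] by linarith
  have "max_degree H = max_degree G + 2"
    unfolding assms(7) by (rule max_degree_cartesian_product_cycle[OF assms(1-3) m(1)])
  then have "real (max_degree H) / 2 + 1 = real (max_degree G) / 2 + 2" by simp
  with central coeff choosable ch AT show ?thesis by blast
qed

end
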